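(* Let $n\ge 1$, let $\mathfrak p_0\in A=\mathbb F_q[T]$ be monic irreducible of degree $r$ with $\gcd(n,r)=1$, let $t\in\mathbb F_{q^r}$ be a root of $\mathfrak p_0$, let $\phi$ be the Drinfeld module with $\phi_T=t+\tau^n$, and let $\mathfrak p\ne\mathfrak p_0$ be a monic irreducible element of $A$. Put $\kappa=A/\mathfrak p$, $M=\phi[\mathfrak p]$, $\pi=\tau^r$ and $c=\mathfrak p_0\bmod\mathfrak p\in\kappa^\times$. Then: (1) $\pi^n$ acts on $M$ as the scalar $c$, and the characteristic polynomial of $\pi|_M$ over $\kappa$ is $X^n-c$, i.e. the reduction modulo $\mathfrak p$ of $X^n-\mathfrak p_0$. (2) The minimal polynomial of $\pi|_M$ over $\kappa$ is also $X^n-c$; that is, $\pi|_M$ is non-derogatory.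
   Context: $q$ is a prime power, $A=\mathbb F_q[T]$, and $\overline{\mathbb F}_q$ is a fixed algebraic closure containing all finite extensions of $\mathbb F_q$ considered. For $i\ge0$ write $[i]=q^i$, so $\beta^{[i]}=\beta^{q^i}$. $\mathbb F_{q^r}\{\tau\}$ is the twisted polynomial ring with $\tau a=a^q\tau$; it acts on $\overline{\mathbb F}_q$ with $\tau$ acting as $x\mapsto x^q$ and constants by multiplication. The Drinfeld module $\phi$ is the $\mathbb F_q$-algebra homomorphism $A\to\mathbb F_{q^r}\{\tau\}$, $a\mapsto\phi_a$, determined by $\phi_T=t+\tau^n$. Its $\mathfrak p$-torsion is $M=\phi[\mathfrak p]=\{v\in\overline{\mathbb F}_q:\phi_{\mathfrak p}(v)=0\}$, on which $a\in A$ acts by $v\mapsto\phi_a(v)$; this makes $M$ a $\kappa$-vector space of dimension $n$. The element $\pi=\tau^r$ commutes with all $\phi_a$, hence acts $\kappa$-linearly on $M$ by $v\mapsto v^{[r]}$; this operator is $\pi|_M$. A linear operator is non-derogatory if its minimal polynomial equals its characteristic polynomial. *)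

theory Defs
  imports
    "HOL-Algebra.Algebraic_Closure_Type"
    "HOL-Algebra.UnivPoly"
    "HOL-Library.Cardinality"
    "Jordan_Normal_Form.Missing_VectorSpace"
begin

section \<open>Linear operators over a field given by a carrier\<close>

definition ring_det :: "('r, 'm) ring_scheme \<Rightarrow> nat \<Rightarrow> (nat \<Rightarrow> nat \<Rightarrow> 'r) \<Rightarrow> 'r" where
  "ring_det R n B =
     (\<Oplus>\<^bsub>R\<^esub>\<sigma>\<in>{\<sigma>. \<sigma> permutes {..<n}}.
        add_pow R (sign \<sigma>) (\<Otimes>\<^bsub>R\<^esub>i\<in>{..<n}. B i (\<sigma> i)))"

definition mat_char_poly :: "('k, 'm) ring_scheme \<Rightarrow> nat \<Rightarrow> (nat \<Rightarrow> nat \<Rightarrow> 'k) \<Rightarrow> (nat \<Rightarrow> 'k)" where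
  "mat_char_poly K n B =
     ring_det (UP K) n
       (\<lambda>i j. (if i = j then up_ring.monom (UP K) \<one>\<^bsub>K\<^esub> 1 else \<zero>\<^bsub>UP K\<^esub>)
              \<ominus>\<^bsub>UP K\<^esub> up_ring.monom (UP K) (B i j) 0)"

text \<open>\<open>bs\<close> is an ordered basis of \<open>V\<close>, and \<open>B\<close> is the matrix of \<open>f\<close> in it: column \<open>j\<close> holds the
  coordinates of the image of the \<open>j\<close>-th basis vector.\<close>

definition is_matrix_of ::
  "('k, 'm) ring_scheme \<Rightarrow> ('k, 'v, 'l) module_scheme \<Rightarrow> ('v \<Rightarrow> 'v) \<Rightarrow> 'v list \<Rightarrow> (nat \<Rightarrow> nat \<Rightarrow> 'k) \<Rightarrow> bool"
  where
  "is_matrix_of K V f bs B \<longleftrightarrow>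
     distinct bs \<and> vectorspace.basis K V (set bs) \<and>
     (\<forall>i<length bs. \<forall>j<length bs. B i j \<in> carrier K) \<and>
     (\<forall>j<length bs. f (bs ! j) = (\<Oplus>\<^bsub>V\<^esub>i\<in>{..<length bs}. B i j \<odot>\<^bsub>V\<^esub> bs ! i))"

text \<open>The characteristic polynomial does not depend on the basis. Rather than picking a basis,
  the definition asks that there be a finite one and that all of them give \<open>\<chi>\<close>.\<close>

definition is_char_poly ::
  "('k, 'm) ring_scheme \<Rightarrow> ('k, 'v, 'l) module_scheme \<Rightarrow> ('v \<Rightarrow> 'v) \<Rightarrow> (nat \<Rightarrow> 'k) \<Rightarrow> bool"
  where
  "is_char_poly K V f \<chi> \<longleftrightarrow>
     linear_map K V V f \<and>
     (\<exists>bs B. is_matrix_of K V f bs B) \<and>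
     (\<forall>bs B. is_matrix_of K V f bs B \<longrightarrow> mat_char_poly K (length bs) B = \<chi>)"

definition annihilates ::
  "('k, 'm) ring_scheme \<Rightarrow> ('k, 'v, 'l) module_scheme \<Rightarrow> (nat \<Rightarrow> 'k) \<Rightarrow> ('v \<Rightarrow> 'v) \<Rightarrow> bool"
  where
  "annihilates K V g f \<longleftrightarrow>
     (\<forall>v\<in>carrier V.
        (\<Oplus>\<^bsub>V\<^esub>i\<in>{..deg K g}. up_ring.coeff (UP K) g i \<odot>\<^bsub>V\<^esub> (f ^^ i) v) = \<zero>\<^bsub>V\<^esub>)"

definition is_min_poly ::
  "('k, 'm) ring_scheme \<Rightarrow> ('k, 'v, 'l) module_scheme \<Rightarrow> ('v \<Rightarrow> 'v) \<Rightarrow> (nat \<Rightarrow> 'k) \<Rightarrow> bool"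
  where
  "is_min_poly K V f \<mu> \<longleftrightarrow>
     linear_map K V V f \<and>
     \<mu> \<in> carrier (UP K) \<and> up_ring.coeff (UP K) \<mu> (deg K \<mu>) = \<one>\<^bsub>K\<^esub> \<and>
     annihilates K V \<mu> f \<and>
     (\<forall>g\<in>carrier (UP K). g \<noteq> \<zero>\<^bsub>UP K\<^esub> \<and> annihilates K V g f \<longrightarrow> deg K \<mu> \<le> deg K g)"

definition non_derogatory ::
  "('k, 'm) ring_scheme \<Rightarrow> ('k, 'v, 'l) module_scheme \<Rightarrow> ('v \<Rightarrow> 'v) \<Rightarrow> bool"
  where
  "non_derogatory K V f \<longleftrightarrow> (\<exists>\<chi>. is_char_poly K V f \<chi> \<and> is_min_poly K V f \<chi>)"

definition reduce_coeffs :: "('r, 'm) ring_scheme \<Rightarrow> 'r set \<Rightarrow> (nat \<Rightarrow> 'r) \<Rightarrow> (nat \<Rightarrow> 'r set)" where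
  "reduce_coeffs R I f = (\<lambda>i. I +>\<^bsub>R\<^esub> up_ring.coeff (UP R) f i)"

section \<open>Twisted polynomials\<close>

text \<open>The base field of order \<open>q = CARD('a)\<close> is the type \<open>'a\<close>, and all finite extensions live in
  its algebraic closure \<open>'a alg_closure\<close>. The extension of degree \<open>r\<close> is the set of fixed points
  of the \<open>r\<close>-th power of the Frobenius map.\<close>

definition ext_field :: "nat \<Rightarrow> 'a :: finite_field alg_closure set" where
  "ext_field r = {x. x ^ (CARD('a) ^ r) = x}"

text \<open>A twisted polynomial, with coefficients written to the left of the powers of \<open>\<tau>\<close>, is
  represented by the ordinary polynomial with the same coefficients. The product is determined by
  \<open>(a \<tau>^i) (b \<tau>^j) = a b^(q^i) \<tau>^(i + j)\<close>.\<close>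

definition twisted_mult ::
  "'a :: finite_field alg_closure poly \<Rightarrow> 'a alg_closure poly \<Rightarrow> 'a alg_closure poly" where
  "twisted_mult f g =
     (\<Sum>i\<le>degree f. \<Sum>j\<le>degree g.
        Polynomial.monom (Polynomial.coeff f i * Polynomial.coeff g j ^ (CARD('a) ^ i)) (i + j))"

definition twisted_poly_ring :: "nat \<Rightarrow> 'a :: finite_field alg_closure poly ring" where
  "twisted_poly_ring r =
     \<lparr>carrier = {f. \<forall>i. Polynomial.coeff f i \<in> ext_field r},
      monoid.mult = twisted_mult, one = 1, ring.zero = 0, add = (+)\<rparr>"

definition twisted_const :: "'a :: finite_field alg_closure \<Rightarrow> 'a alg_closure poly" where
  "twisted_const a = [:a:]"

definition tau_pow :: "nat \<Rightarrow> 'a :: finite_field alg_closure poly" where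
  "tau_pow k = Polynomial.monom 1 k"

definition twisted_act ::
  "'a :: finite_field alg_closure poly \<Rightarrow> 'a alg_closure \<Rightarrow> 'a alg_closure" where
  "twisted_act f v = (\<Sum>i\<le>degree f. Polynomial.coeff f i * v ^ (CARD('a) ^ i))"

section \<open>The Drinfeld module and its torsion\<close>

abbreviation poly_A :: "'a :: finite_field poly ring" where
  "poly_A \<equiv> ring_of_type_algebra"

definition drinfeld_module ::
  "nat \<Rightarrow> nat \<Rightarrow> 'a :: finite_field alg_closure \<Rightarrow> ('a poly \<Rightarrow> 'a alg_closure poly) \<Rightarrow> bool" where
  "drinfeld_module r n t \<phi> \<longleftrightarrow>
     \<phi> \<in> ring_hom poly_A (twisted_poly_ring r) \<and>
     (\<forall>c. \<phi> [:c:] = twisted_const (to_ac c)) \<and>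
     \<phi> [:0, 1:] = twisted_const t + tau_pow n"

definition residue_class_ring :: "'a :: finite_field poly \<Rightarrow> 'a poly set ring" where
  "residue_class_ring p = poly_A Quot (PIdl\<^bsub>poly_A\<^esub> p)"

text \<open>A residue class acts through any of its representatives. The multiplication and the one of
  the module record play no role.\<close>

definition torsion_module ::
  "('a :: finite_field poly \<Rightarrow> 'a alg_closure poly) \<Rightarrow> 'a poly \<Rightarrow> ('a poly set, 'a alg_closure) module"
  where
  "torsion_module \<phi> p =
     \<lparr>carrier = {v. twisted_act (\<phi> p) v = 0},
      monoid.mult = undefined, one = undefined, ring.zero = 0, add = (+),
      module.smult = (\<lambda>C v. twisted_act (\<phi> (SOME a. a \<in> C)) v)\<rparr>"

end

theory Submission
  imports Defs "Jordan_Normal_Form.Char_Poly"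
begin

text \<open>
  Write \<open>q\<close> for the order of the base field, \<open>r\<close> for the degree of \<open>p0\<close> and \<open>T = t + \<tau>^n\<close>, an operator
  on the algebraic closure; \<open>\<phi>_a\<close> is \<open>a(T)\<close>. The whole proof rests on Newton interpolation at the
  conjugates of \<open>t\<close>. Since \<open>\<tau>^(n k) T = t^(q^(n k)) \<tau>^(n k) + \<tau>^(n (k + 1))\<close>, induction on \<open>k\<close> shows
  that the product of the \<open>X - t^(q^(n l))\<close> over \<open>l < k\<close>, evaluated at \<open>T\<close> with its coefficients
  on the left, is \<open>\<tau>^(n k)\<close> (lemma \<open>ev_newton\<close>, with an additional power of \<open>\<tau>\<close> carried along).

  Because \<open>n\<close> and \<open>r\<close> are coprime, for \<open>k = r\<close> this product runs over the \<open>r\<close> different roots of \<open>p0\<close>,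
  so it is \<open>p0\<close>, and \<open>\<phi>_p0 = \<tau>^(n r) = \<pi>^n\<close> (lemma \<open>act_p0\<close>). Thus \<open>\<pi>^n\<close> acts as \<open>c\<close>.

  The other half is the independence of \<open>1, \<pi>, ..., \<pi>^(n - 1)\<close> over \<open>\<kappa>\<close> on \<open>M\<close> (lemma
  \<open>frobenius_powers_independent\<close>). The kernel of \<open>\<phi>_p\<close> has exactly \<open>q^(n deg p)\<close> elements, as the
  polynomial inducing \<open>\<phi>_p\<close> has the constant derivative \<open>p(t)\<close>, and \<open>p(t)\<close> is not \<open>0\<close> because \<open>p\<close>
  differs from \<open>p0\<close>. Consider a sum over \<open>j < n\<close> of operators
  \<open>F_j \<star> \<tau>^j\<close>, meaning \<open>v \<mapsto> \<Sum>k. F_{j,k} \<tau>^j (T^k v)\<close>, where \<open>F_j\<close> is a polynomial over the closure.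
  If it kills \<open>M\<close>, then \<open>p\<close> divides each \<open>F_j\<close> (lemma \<open>ev_vanish_dvd\<close>): modulo \<open>p\<close> one may assume that
  \<open>F_j\<close> has degree less than \<open>deg p\<close>; then the \<open>\<tau>\<close>-degrees \<open>n k + j\<close> that occur are pairwise different
  and less than \<open>n deg p\<close>, so the sum is a polynomial with more zeros than its degree allows. Now
  \<open>\<pi>^i = \<tau>^(r i)\<close>, and writing \<open>r i = n k_i + j_i\<close> with \<open>j_i < n\<close>, the remainders \<open>j_i\<close> are pairwise
  different, again by coprimality. By Newton interpolation, \<open>\<phi>_a \<pi>^i\<close> is \<open>(N a) \<star> \<tau>^(j_i)\<close> where
  \<open>N\<close> is a product of linear factors at conjugates of \<open>t\<close>. None of these is a root of \<open>p\<close>, so that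
  divisibility of \<open>N a\<close> by \<open>p\<close> passes to \<open>a\<close>.

  Independence says that no polynomial over \<open>\<kappa>\<close> of degree less than \<open>n\<close>, except \<open>0\<close>, annihilates \<open>\<pi>\<close>;
  hence \<open>X^n - c\<close> is the minimal polynomial. By counting, \<open>M\<close> has dimension \<open>n\<close> over \<open>\<kappa>\<close>. Given a matrix
  of \<open>\<pi>\<close> in some basis, lift its entries to \<open>A\<close>: by Cayley-Hamilton over the commutative ring \<open>A\<close> the
  characteristic polynomial of the lift is monic of degree \<open>n\<close> and annihilates \<open>\<pi>\<close>, so by independence
  it is congruent to \<open>X^n - p0\<close> modulo \<open>p\<close> (lemma \<open>monic_annihilator_unique\<close>).
\<close>

section \<open>Frobenius maps on the algebraic closure\<close>

lemma of_nat_card_alg_closure: "of_nat CARD('a) = (0 :: 'a :: finite_field alg_closure)"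
proof -
  have "(\<Sum>x\<in>(UNIV :: 'a set). x + 1) = \<Sum>UNIV"
    by (rule sum.reindex_bij_witness[of _ "\<lambda>x. x - 1" "\<lambda>x. x + 1"]) auto
  then have "of_nat CARD('a) = (0 :: 'a)"
    by (simp add: sum.distrib)
  then show ?thesis
    by (metis to_ac_0 to_ac_of_nat)
qed

lemma card_range_to_ac: "card (range (to_ac :: 'a :: finite_field \<Rightarrow> _)) = CARD('a)"
  by (rule card_image) (rule inj_to_ac)

lemma two_le_card_field: "CARD('a :: finite_field) \<ge> 2"
proof -
  have "card {0, 1 :: 'a} \<le> CARD('a)"
    by (rule card_mono) auto
  then show ?thesis by simp
qed

lemma zero_less_card_field: "CARD('a :: finite_field) > 0"
  using two_le_card_field[where 'a = 'a] by simp

text \<open>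
Additivity of the Frobenius map by interpolation:
\<open>(X + y)^q - X^q - y^q\<close> has degree less than \<open>q\<close> in \<open>X\<close>, so it vanishes identically once it
vanishes on the \<open>q\<close> elements of the base field. It is used twice, first for \<open>y\<close> in the base
field, where the elements of the base field satisfy \<open>a^q = a\<close>, and then for every \<open>y\<close>.
\<close>

lemma frobenius_add_if_base_field:
  fixes y :: "'a :: finite_field alg_closure"
  assumes "\<And>a. (to_ac a + y) ^ CARD('a) = to_ac a ^ CARD('a) + y ^ CARD('a)"
  shows "(x + y) ^ CARD('a) = x ^ CARD('a) + y ^ CARD('a)"
proof -
  let ?q = "CARD('a)"
  define f where "f = [:y, 1:] ^ ?q - (monom 1 ?q + [:y ^ ?q:])"
  have pf: "poly f z = (z + y) ^ ?q - (z ^ ?q + y ^ ?q)" for z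
    by (simp add: f_def poly_monom add.commute)
  have q: "?q > 0" by (rule zero_less_card_field)
  have m: "degree ([:y, 1:] ^ ?q) = ?q" "coeff ([:y, 1:] ^ ?q) ?q = 1"
    using degree_power_eq[of "[:y, 1:]" ?q] lead_coeff_power[of "[:y, 1:]" ?q] by auto
  have "degree (monom 1 ?q + [:y ^ ?q:]) \<le> ?q"
    by (intro degree_add_le) (auto simp: degree_monom_le)
  then have "degree f \<le> ?q"
    unfolding f_def using m by (intro degree_diff_le) auto
  moreover have "coeff f ?q = 0"
    using m q by (auto simp: f_def coeff_pCons split: nat.splits)
  ultimately have *: "f = 0 \<or> degree f < ?q"
    by (rule eq_zero_or_degree_less)
  have "f = 0"
  proof (rule ccontr)
    assume "f \<noteq> 0"
    then have "card {z. poly f z = 0} \<le> degree f"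
      by (rule card_poly_roots_bound)
    moreover have "card (range (to_ac :: 'a \<Rightarrow> _)) \<le> card {z. poly f z = 0}"
      using \<open>f \<noteq> 0\<close> assms by (intro card_mono poly_roots_finite) (auto simp: pf)
    ultimately show False
      using * \<open>f \<noteq> 0\<close> by (simp add: card_range_to_ac)
  qed
  then show ?thesis
    using pf[of x] by simp
qed

lemma frobenius_add_once:
  fixes x y :: "'a :: finite_field alg_closure"
  shows "(x + y) ^ CARD('a) = x ^ CARD('a) + y ^ CARD('a)"
proof (rule frobenius_add_if_base_field)
  fix a :: 'a
  have "(to_ac c + to_ac a) ^ CARD('a) = to_ac c ^ CARD('a) + to_ac a ^ CARD('a)" for c :: 'a
    by (simp add: finite_field_power_card_eq_same flip: to_ac_power to_ac_add)
  then have "(y + to_ac a) ^ CARD('a) = y ^ CARD('a) + to_ac a ^ CARD('a)"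
    by (rule frobenius_add_if_base_field)
  then show "(to_ac a + y) ^ CARD('a) = to_ac a ^ CARD('a) + y ^ CARD('a)"
    by (simp add: add.commute)
qed

lemma frobenius_add:
  fixes x y :: "'a :: finite_field alg_closure"
  shows "(x + y) ^ (CARD('a) ^ i) = x ^ (CARD('a) ^ i) + y ^ (CARD('a) ^ i)"
proof (induction i arbitrary: x y)
  case (Suc i)
  then show ?case by (simp add: power_mult frobenius_add_once)
qed simp

lemma frobenius_zero [simp]: "(0 :: 'a :: finite_field alg_closure) ^ (CARD('a) ^ i) = 0"
  using zero_less_card_field[where 'a = 'a] by (simp add: zero_power)

lemma frobenius_sum:
  fixes f :: "'b \<Rightarrow> 'a :: finite_field alg_closure"
  shows "(\<Sum>x\<in>A. f x) ^ (CARD('a) ^ i) = (\<Sum>x\<in>A. f x ^ (CARD('a) ^ i))"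
  by (induction A rule: infinite_finite_induct) (simp_all add: frobenius_add)

lemma frobenius_inj:
  fixes x y :: "'a :: finite_field alg_closure"
  shows "x ^ (CARD('a) ^ i) = y ^ (CARD('a) ^ i) \<longleftrightarrow> x = y"
proof
  assume *: "x ^ (CARD('a) ^ i) = y ^ (CARD('a) ^ i)"
  have "(x - y + y) ^ (CARD('a) ^ i) = (x - y) ^ (CARD('a) ^ i) + y ^ (CARD('a) ^ i)"
    by (rule frobenius_add)
  then have "(x - y) ^ (CARD('a) ^ i) = 0"
    using * by simp
  then show "x = y" by simp
qed simp

lemma frobenius_to_ac [simp]: "to_ac (c :: 'a :: finite_field) ^ (CARD('a) ^ i) = to_ac c"
  by (simp add: finite_field_power_card_power_eq_same flip: to_ac_power)

lemma frobenius_frobenius: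
  fixes x :: "'a :: finite_field alg_closure"
  shows "(x ^ (CARD('a) ^ i)) ^ (CARD('a) ^ j) = x ^ (CARD('a) ^ (i + j))"
  by (simp add: power_mult power_add)

lemma frobenius_fixed_mult:
  fixes x :: "'a :: finite_field alg_closure"
  assumes "x ^ (CARD('a) ^ m) = x"
  shows "x ^ (CARD('a) ^ (m * k)) = x"
  by (induction k) (simp_all add: assms flip: frobenius_frobenius)

section \<open>Polynomials over a field and their roots\<close>

text \<open>
The usual argument with a nonzero element of least degree in the ideal generated by \<open>a\<close> and \<open>p\<close>.
It serves twice: for inverses modulo \<open>p\<close>, and to exclude common roots.
\<close>

lemma irreducible_bezout:
  fixes p a :: "'a :: field poly"
  assumes "irreducible p" "\<not> p dvd a"
  shows "\<exists>u w. u * a + w * p = 1"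
proof -
  define S where "S = {m. m \<noteq> 0 \<and> (\<exists>u w. m = u * a + w * p)}"
  have "p = 0 * a + 1 * p" "p \<noteq> 0"
    using assms by (auto simp: irreducible_def)
  then have "p \<in> S" unfolding S_def by blast
  obtain m where m: "m \<in> S" "\<And>x. x \<in> S \<Longrightarrow> degree m \<le> degree x"
    using ex_has_least_nat[of "\<lambda>x. x \<in> S" p degree] \<open>p \<in> S\<close> by blast
  from m(1) obtain u w where uw: "m = u * a + w * p" and "m \<noteq> 0"
    unfolding S_def by blast
  have dvd: "m dvd x" if x: "x = u' * a + w' * p" for x u' w'
  proof (rule ccontr)
    assume "\<not> m dvd x"
    then have "x mod m \<noteq> 0" by auto
    moreover have "x mod m = (u' - x div m * u) * a + (w' - x div m * w) * p"
      using div_mult_mod_eq[of x m] unfolding x uw by (simp add: algebra_simps)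
    ultimately have "x mod m \<in> S" unfolding S_def by blast
    then show False
      using m(2) degree_mod_less'[of m x] \<open>m \<noteq> 0\<close> \<open>x mod m \<noteq> 0\<close> by fastforce
  qed
  have "m dvd p" "m dvd a"
    using dvd[of p 0 1] dvd[of a 1 0] by auto
  then have "is_unit m"
    using assms by (meson dvd_trans irreducibleD')
  then obtain v where "1 = m * v" by (elim dvdE)
  then have "(v * u) * a + (v * w) * p = 1"
    unfolding uw by (simp add: algebra_simps)
  then show ?thesis by blast
qed

lemma poly_to_ac_add: "map_poly to_ac (a + b) = map_poly to_ac a + map_poly to_ac b"
  by (rule poly_eqI) (simp add: coeff_map_poly)

lemma poly_to_ac_mult: "map_poly to_ac (a * b) = map_poly to_ac a * map_poly to_ac b"
  by (rule poly_eqI) (simp add: coeff_map_poly coeff_mult to_ac_sum)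

lemma poly_to_ac_diff: "map_poly to_ac (a - b) = map_poly to_ac a - map_poly to_ac b"
  by (rule poly_eqI) (simp add: coeff_map_poly)

lemma degree_poly_to_ac [simp]: "degree (map_poly to_ac a) = degree a"
  by (rule degree_map_poly) simp

lemma poly_to_ac_eq_0_iff [simp]: "map_poly to_ac a = 0 \<longleftrightarrow> a = 0"
  by (rule map_poly_eq_0_iff) simp_all

lemma irreducible_no_common_root:
  fixes p a :: "'a :: field poly"
  assumes "irreducible p" "\<not> p dvd a" "poly (map_poly to_ac p) s = 0"
  shows "poly (map_poly to_ac a) s \<noteq> 0"
proof
  assume "poly (map_poly to_ac a) s = 0"
  moreover obtain u w where "u * a + w * p = 1"
    using irreducible_bezout[OF assms(1,2)] by blast
  then have "poly (map_poly to_ac (u * a + w * p)) s = 1" by simp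
  ultimately show False
    using assms(3) by (simp add: poly_to_ac_add poly_to_ac_mult)
qed

lemma poly_to_ac_dvd_iff:
  fixes p a :: "'a :: field poly"
  shows "map_poly to_ac p dvd map_poly to_ac a \<longleftrightarrow> p dvd a"
proof
  assume *: "map_poly to_ac p dvd map_poly to_ac a"
  have "map_poly to_ac (a mod p) = map_poly to_ac a - map_poly to_ac p * map_poly to_ac (a div p)"
    by (simp flip: poly_to_ac_mult poly_to_ac_diff add: minus_mult_div_eq_mod)
  then have "map_poly to_ac p dvd map_poly to_ac (a mod p)"
    using * by simp
  then have "degree p \<le> degree (a mod p)" if "a mod p \<noteq> 0"
    using dvd_imp_degree_le[of "map_poly to_ac p" "map_poly to_ac (a mod p)"] that
    by (simp only: degree_poly_to_ac poly_to_ac_eq_0_iff simp_thms)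
  then have "p \<noteq> 0 \<Longrightarrow> a mod p = 0"
    using degree_mod_less'[of p a] by fastforce
  moreover have "p = 0 \<Longrightarrow> a = 0" using * by simp
  ultimately have "a mod p = 0" by fastforce
  then show "p dvd a" by auto
next
  assume "p dvd a"
  then show "map_poly to_ac p dvd map_poly to_ac a"
    by (auto elim!: dvdE simp: poly_to_ac_mult)
qed

lemma dvd_cancel_linear_factors:
  fixes P Q :: "'b :: field poly"
  assumes "P dvd (\<Prod>l\<in>I. [:- s l, 1:]) * Q" "\<And>l. l \<in> I \<Longrightarrow> poly P (s l) \<noteq> 0"
  shows "P dvd Q"
  using assms
proof (induction I rule: infinite_finite_induct)
  case (insert l I)
  have "P dvd [:- s l, 1:] * ((\<Prod>l\<in>I. [:- s l, 1:]) * Q)"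
    using insert.prems(1) unfolding prod.insert[OF insert.hyps] by (simp only: mult.assoc)
  then obtain R where R: "[:- s l, 1:] * ((\<Prod>l\<in>I. [:- s l, 1:]) * Q) = P * R"
    by (elim dvdE)
  from arg_cong[OF R, of "\<lambda>x. poly x (s l)"] have "poly R (s l) = 0"
    using insert.prems(2)[of l] by simp
  then obtain R' where "R = [:- s l, 1:] * R'"
    by (auto simp: poly_eq_0_iff_dvd elim: dvdE)
  with R have "[:- s l, 1:] * ((\<Prod>l\<in>I. [:- s l, 1:]) * Q) = [:- s l, 1:] * (P * R')"
    by (simp only: mult.left_commute)
  then have "(\<Prod>l\<in>I. [:- s l, 1:]) * Q = P * R'"
    by (subst (asm) mult_cancel_left) auto
  then have "P dvd (\<Prod>l\<in>I. [:- s l, 1:]) * Q" by simp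
  then show ?case
    using insert.IH insert.prems(2) by blast
qed auto

lemma prod_linear_factors_dvd:
  fixes P :: "'b :: field poly"
  assumes "inj_on s I" "\<And>l. l \<in> I \<Longrightarrow> poly P (s l) = 0" "finite I"
  shows "(\<Prod>l\<in>I. [:- s l, 1:]) dvd P"
  using assms(3,1,2)
proof (induction I rule: finite_induct)
  case (insert l I)
  then obtain U where U: "P = (\<Prod>l\<in>I. [:- s l, 1:]) * U"
    by (metis dvdE inj_on_insert insertCI)
  have "poly (\<Prod>l\<in>I. [:- s l, 1:]) (s l) \<noteq> 0"
    using insert by (auto simp: poly_prod inj_on_def)
  then have "poly U (s l) = 0"
    using insert.prems(2)[of l] U by simp
  then obtain V where V: "U = [:- s l, 1:] * V"
    by (metis dvdE poly_eq_0_iff_dvd)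
  have "P = (\<Prod>l\<in>insert l I. [:- s l, 1:]) * V"
    unfolding U V prod.insert[OF insert.hyps] by (simp only: mult_ac)
  then show ?case by (rule dvdI)
qed simp

lemma bij_betw_Poly_lists:
  assumes "d > 0"
  shows "bij_betw Poly {xs :: 'a :: zero list. length xs = d} {a. degree a < d}"
proof (rule bij_betwI[where g = "\<lambda>a. map (coeff a) [0..<d]"])
  show "Poly \<in> {xs :: 'a list. length xs = d} \<rightarrow> {a. degree a < d}"
  proof
    fix xs :: "'a list"
    assume "xs \<in> {xs. length xs = d}"
    then have "degree (Poly xs) < d"
      using assms by (intro degree_lessI) (auto simp: nth_default_def)
    then show "Poly xs \<in> {a. degree a < d}" by simp
  qed
  show "(\<lambda>a. map (coeff a) [0..<d]) \<in> {a. degree a < d} \<rightarrow> {xs :: 'a list. length xs = d}"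
    by auto
  show "map (coeff (Poly xs)) [0..<d] = xs" if "xs \<in> {xs. length xs = d}" for xs :: "'a list"
    using that by (intro nth_equalityI) (auto simp: nth_default_def)
  show "Poly (map (coeff a) [0..<d]) = a" if "a \<in> {a. degree a < d}" for a :: "'a poly"
    using that by (intro poly_eqI) (auto simp: nth_default_def coeff_eq_0)
qed

lemma card_polys_degree_less:
  assumes "d > 0"
  shows "card {a :: 'a :: {zero, finite} poly. degree a < d} = CARD('a) ^ d"
proof -
  have "card {xs :: 'a list. length xs = d} = CARD('a) ^ d"
    using card_lists_length_eq[of "UNIV :: 'a set" d] by simp
  then show ?thesis
    using bij_betw_same_card[OF bij_betw_Poly_lists[OF assms, where 'a = 'a]] by simp
qed

text \<open>
Among the terms with a nonzero coefficient, the one of largest degree cannot be cancelled.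
\<close>

lemma sum_monic_distinct_degrees_eq_0:
  fixes P :: "'i \<Rightarrow> 'b :: idom poly"
  assumes "finite I" "inj_on (\<lambda>i. degree (P i)) I" "\<And>i. i \<in> I \<Longrightarrow> lead_coeff (P i) = 1"
    and "(\<Sum>i\<in>I. smult (c i) (P i)) = 0" and "i \<in> I"
  shows "c i = 0"
proof (rule ccontr)
  assume "c i \<noteq> 0"
  define J where "J = {i\<in>I. c i \<noteq> 0}"
  have "finite J" "J \<noteq> {}"
    using assms \<open>c i \<noteq> 0\<close> by (auto simp: J_def)
  define e where "e = Max ((\<lambda>i. degree (P i)) ` J)"
  have "e \<in> (\<lambda>i. degree (P i)) ` J"
    unfolding e_def using \<open>finite J\<close> \<open>J \<noteq> {}\<close> by (intro Max_in) auto
  then obtain m where m: "m \<in> J" "e = degree (P m)" by auto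
  have "c k * coeff (P k) e = 0" if "k \<in> I - {m}" for k
  proof (cases "k \<in> J")
    case True
    then have "degree (P k) \<le> e"
      unfolding e_def using \<open>finite J\<close> by (intro Max_ge) auto
    moreover have "degree (P k) \<noteq> e"
      using that m assms(2) True by (auto simp: J_def inj_on_def)
    ultimately show ?thesis by (simp add: coeff_eq_0)
  qed (use that in \<open>auto simp: J_def\<close>)
  then have "(\<Sum>k\<in>I - {m}. c k * coeff (P k) e) = 0"
    by (rule sum.neutral[rule_format])
  moreover have "m \<in> I" using m by (simp add: J_def)
  ultimately have "(\<Sum>k\<in>I. c k * coeff (P k) e) = c m * coeff (P m) e"
    using assms(1) by (simp add: sum.remove[of I m])
  moreover have "(\<Sum>k\<in>I. c k * coeff (P k) e) = 0"
    using arg_cong[OF assms(4), of "\<lambda>x. coeff x e"] by (simp add: coeff_sum)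
  ultimately show False
    using m assms(3)[of m] by (auto simp: J_def)
qed

text \<open>
A multiple root would also be a root of the derivative.
\<close>

lemma card_roots_separable:
  fixes P :: "'b :: alg_closed_field poly"
  assumes "pderiv P = [:c:]" "c \<noteq> 0"
  shows "card {x. poly P x = 0} = degree P"
proof -
  have "P \<noteq> 0" using assms by auto
  then obtain A where A: "size A = degree P" "P = smult (lead_coeff P) (\<Prod>x\<in>#A. [:-x, 1:])"
    using alg_closed_imp_factorization by blast
  have "count A x \<le> 1" for x
  proof (rule ccontr)
    assume "\<not> count A x \<le> 1"
    then have "{#x, x#} \<subseteq># A"
      by (auto simp: subseteq_mset_def)
    then obtain B where "A = add_mset x (add_mset x B)"
      by (auto simp: mset_subset_eq_exists_conv)
    then have "P = [:-x, 1:] * ([:-x, 1:] * smult (lead_coeff P) (\<Prod>x\<in>#B. [:-x, 1:]))"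
      using A(2) by simp
    then obtain Q where "P = [:-x, 1:] * ([:-x, 1:] * Q)" by blast
    then have "poly (pderiv P) x = 0"
      by (simp only: pderiv_mult poly_add poly_mult) simp
    then show False using assms by simp
  qed
  then have *: "size A = card (set_mset A)"
    by (metis (no_types, lifting) One_nat_def count_eq_zero_iff le_SucE le_zero_eq size_multiset_overloaded_eq
        card_eq_sum sum.cong)
  have "{x. poly P x = 0} = set_mset A"
    by (subst A(2)) (use \<open>P \<noteq> 0\<close> in \<open>auto simp: poly_prod_mset prod_mset_zero_iff image_iff\<close>)
  then show ?thesis using A * by simp
qed

text \<open>
The residues modulo \<open>f\<close>, evaluated at \<open>t\<close>, give \<open>q^(deg f)\<close> different elements of every field of
fixed points \<open>x^(q^g) = x\<close> that contains \<open>t\<close>. Such a field has at most \<open>q^g\<close> elements, hence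
\<open>deg f \<le> g\<close>. This is applied to \<open>g = gcd m (deg f)\<close>; by Bezout, \<open>t\<close> lies in that field since both
exponents fix it.
\<close>

lemma root_period_multiple_of_degree:
  fixes f :: "'a :: finite_field poly"
  assumes "irreducible f" "poly (map_poly to_ac f) t = 0"
    and "t ^ (CARD('a) ^ degree f) = t" "t ^ (CARD('a) ^ m) = t"
  shows "degree f dvd m"
proof (cases "m = 0")
  case False
  let ?q = "CARD('a)"
  define r where "r = degree f"
  have "r > 0"
    using assms(1) by (auto simp: r_def irreducible_def is_unit_iff_degree)
  define g where "g = gcd m r"
  obtain x y where xy: "m * x = r * y + g"
    using bezout_nat[OF False] unfolding g_def by blast
  have "(t ^ (?q ^ (r * y))) ^ (?q ^ g) = t ^ (?q ^ (m * x))"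
    unfolding frobenius_frobenius xy ..
  then have tg: "t ^ (?q ^ g) = t"
    using assms(3,4) by (simp add: frobenius_fixed_mult r_def)
  define fixed where "fixed = {x :: 'a alg_closure. x ^ (?q ^ g) = x}"
  define P where "P = monom 1 (?q ^ g) - [:0, 1 :: 'a alg_closure:]"
  have g: "g > 0" "g dvd r" using \<open>r > 0\<close> by (auto simp: g_def)
  then have "1 < ?q ^ g"
    using two_le_card_field[where 'a = 'a] by (intro one_less_power) auto
  then have "coeff P (?q ^ g) = 1"
    using g by (auto simp: P_def coeff_pCons split: nat.splits)
  then have "P \<noteq> 0" by auto
  have "degree P \<le> ?q ^ g"
    unfolding P_def using \<open>1 < ?q ^ g\<close> g by (intro degree_diff_le) (auto simp: degree_monom_le)
  moreover have "fixed = {x. poly P x = 0}"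
    by (auto simp: fixed_def P_def poly_monom)
  ultimately have fixed: "finite fixed" "card fixed \<le> ?q ^ g"
    using poly_roots_finite[OF \<open>P \<noteq> 0\<close>] card_poly_roots_bound[OF \<open>P \<noteq> 0\<close>] by auto
  have "inj_on (\<lambda>a. poly (map_poly to_ac a) t) {a. degree a < r}"
  proof (rule inj_onI)
    fix a b
    assume ab: "a \<in> {a. degree a < r}" "b \<in> {a. degree a < r}"
      "poly (map_poly to_ac a) t = poly (map_poly to_ac b) t"
    then have "poly (map_poly to_ac (a - b)) t = 0"
      by (simp add: poly_to_ac_diff)
    then have "f dvd a - b"
      using irreducible_no_common_root[OF assms(1) _ assms(2)] by blast
    moreover have "degree (a - b) < r"
      using ab by (auto intro: degree_diff_less)
    ultimately show "a = b"
      using dvd_imp_degree_le[of f "a - b"] by (auto simp: r_def)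
  qed
  moreover have "(\<lambda>a. poly (map_poly to_ac a) t) ` {a. degree a < r} \<subseteq> fixed"
    by (auto simp: fixed_def poly_altdef frobenius_sum coeff_map_poly power_mult_distrib tg
        simp flip: power_mult)
       (simp add: power_mult tg mult.commute[of _ "?q ^ g"])
  ultimately have "card {a :: 'a poly. degree a < r} \<le> card fixed"
    using fixed by (intro card_inj_on_le)
  then have "?q ^ r \<le> ?q ^ g"
    using fixed \<open>r > 0\<close> by (simp add: card_polys_degree_less)
  then have "r \<le> g"
    using two_le_card_field[where 'a = 'a] by (subst (asm) power_increasing_iff) auto
  then have "g = r" using g \<open>r > 0\<close> dvd_imp_le by fastforce
  then have "gcd m r = r" unfolding g_def .
  then have "r dvd m" by (metis gcd_dvd1)
  then show ?thesis unfolding r_def .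
qed simp

section \<open>Left evaluation at the operator \<open>t + \<tau>^n\<close>\<close>

locale drinfeld_operator =
  fixes n :: nat and t :: "'a :: finite_field alg_closure"
  assumes n_pos: "n \<ge> 1"
begin

definition T :: "'a alg_closure \<Rightarrow> 'a alg_closure" where
  "T v = t * v + v ^ (CARD('a) ^ n)"

text \<open>
\<open>ev F j v\<close> inserts \<open>\<tau>^j\<close> between the coefficients of \<open>F\<close> and the powers of \<open>T\<close>. In general
the coefficients do not commute with \<open>T\<close>, so this is not a ring action of polynomials over the
closure; composition with \<open>act a\<close> on the right does correspond to multiplication by \<open>a\<close>, as \<open>T\<close> is
linear over the base field (lemma \<open>ev_act\<close>).
\<close>

definition ev :: "'a alg_closure poly \<Rightarrow> nat \<Rightarrow> 'a alg_closure \<Rightarrow> 'a alg_closure" where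
  "ev F j v = (\<Sum>k\<le>degree F. coeff F k * ((T ^^ k) v) ^ (CARD('a) ^ j))"

abbreviation act :: "'a poly \<Rightarrow> 'a alg_closure \<Rightarrow> 'a alg_closure" where
  "act a v \<equiv> ev (map_poly to_ac a) 0 v"

lemma T_add: "T (v + w) = T v + T w"
  by (simp add: T_def frobenius_add algebra_simps)

lemma T_0 [simp]: "T 0 = 0"
  by (simp add: T_def)

lemma T_to_ac_mult: "T (to_ac c * v) = to_ac c * T v"
  by (simp add: T_def power_mult_distrib algebra_simps)

lemma T_frobenius:
  assumes "t ^ (CARD('a) ^ m) = t"
  shows "T (v ^ (CARD('a) ^ m)) = T v ^ (CARD('a) ^ m)"
  by (simp add: T_def frobenius_add power_mult_distrib assms frobenius_frobenius add.commute)

lemma T_funpow_add: "(T ^^ k) (v + w) = (T ^^ k) v + (T ^^ k) w"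
  by (induction k) (simp_all add: T_add)

lemma T_funpow_0 [simp]: "(T ^^ k) 0 = 0"
  by (induction k) simp_all

lemma T_funpow_to_ac_mult: "(T ^^ k) (to_ac c * v) = to_ac c * (T ^^ k) v"
  by (induction k) (simp_all add: T_to_ac_mult)

lemma ev_atMost: "degree F \<le> N \<Longrightarrow> ev F j v = (\<Sum>k\<le>N. coeff F k * ((T ^^ k) v) ^ (CARD('a) ^ j))"
  unfolding ev_def by (rule sum.mono_neutral_left) (auto simp: coeff_eq_0)

lemma ev_add: "ev (F + G) j v = ev F j v + ev G j v"
proof -
  let ?N = "max (degree F) (degree G)"
  have "degree (F + G) \<le> ?N" by (rule degree_add_le_max)
  then show ?thesis
    by (simp add: ev_atMost[of _ ?N] sum.distrib algebra_simps)
qed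

lemma ev_0 [simp]: "ev 0 j v = 0"
  by (simp add: ev_def)

lemma ev_smult: "ev (smult c F) j v = c * ev F j v"
  using ev_atMost[of "smult c F" "degree F"]
  by (simp add: ev_def degree_smult_le sum_distrib_left mult.assoc)

lemma ev_pCons: "ev (pCons c F) j v = c * v ^ (CARD('a) ^ j) + ev F j (T v)"
proof -
  have "ev (pCons c F) j v = (\<Sum>k\<le>Suc (degree F). coeff (pCons c F) k * ((T ^^ k) v) ^ (CARD('a) ^ j))"
    by (rule ev_atMost) (rule degree_pCons_le)
  also have "\<dots> = c * v ^ (CARD('a) ^ j) + ev F j (T v)"
    unfolding ev_def sum.atMost_Suc_shift by (simp add: funpow_swap1)
  finally show ?thesis .
qed

lemma ev_add_right: "ev F j (v + w) = ev F j v + ev F j w"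
  by (simp add: ev_def T_funpow_add frobenius_add algebra_simps sum.distrib)

lemma ev_0_right [simp]: "ev F j 0 = 0"
  by (simp add: ev_def)

lemma ev_to_ac_mult_right: "ev F j (to_ac c * v) = to_ac c * ev F j v"
  by (simp add: ev_def T_funpow_to_ac_mult power_mult_distrib sum_distrib_left mult.left_commute)

lemma ev_act: "ev F j (act a v) = ev (F * map_poly to_ac a) j v"
proof (induction a arbitrary: v)
  case (pCons c a)
  have "ev F j (act (pCons c a) v) = to_ac c * ev F j v + ev F j (act a (T v))"
    using pCons.hyps
    by (simp add: map_poly_pCons ev_pCons ev_add_right ev_to_ac_mult_right)
  also have "\<dots> = ev (F * map_poly to_ac (pCons c a)) j v"
    using pCons by (simp add: map_poly_pCons ev_add ev_smult ev_pCons)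
  finally show ?case .
qed simp

lemma act_mult: "act (a * b) v = act a (act b v)"
  by (simp add: ev_act poly_to_ac_mult)

lemma act_add: "act (a + b) v = act a v + act b v"
  by (simp add: poly_to_ac_add ev_add)

lemma ev_1 [simp]: "ev 1 0 v = v"
  by (simp add: ev_def)

lemma act_uminus: "act (- a) v = - act a v"
  using act_add[of a "- a" v] by (simp add: add_eq_0_iff)

lemma act_frobenius:
  assumes "t ^ (CARD('a) ^ m) = t"
  shows "act a (v ^ (CARD('a) ^ m)) = (act a v) ^ (CARD('a) ^ m)"
proof -
  have "(T ^^ k) (v ^ (CARD('a) ^ m)) = ((T ^^ k) v) ^ (CARD('a) ^ m)" for k
    by (induction k) (simp_all add: T_frobenius[OF assms])
  then show ?thesis
    by (simp add: ev_def frobenius_sum power_mult_distrib coeff_map_poly)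
qed

subsection \<open>Newton interpolation\<close>

definition newton :: "nat \<Rightarrow> nat \<Rightarrow> 'a alg_closure poly" where
  "newton j k = (\<Prod>l<k. [:- (t ^ (CARD('a) ^ (j + n * l))), 1:])"

text \<open>
Multiplying a polynomial by \<open>X\<close> means applying \<open>T\<close> first, so the induction step is
\<open>\<tau>^m T = t^(q^m) \<tau>^m + \<tau>^(m + n)\<close> for \<open>m = n k + j\<close>: the new linear factor removes exactly the first
term.
\<close>

lemma ev_newton: "ev (newton j k) j w = w ^ (CARD('a) ^ (n * k + j))"
proof (induction k arbitrary: w)
  case (Suc k)
  let ?s = "t ^ (CARD('a) ^ (j + n * k))"
  have "newton j (Suc k) = smult (- ?s) (newton j k) + pCons 0 (newton j k)"
    by (simp add: newton_def mult.commute)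
  then have "ev (newton j (Suc k)) j w = (T w) ^ (CARD('a) ^ (n * k + j)) - ?s * w ^ (CARD('a) ^ (n * k + j))"
    by (simp only: ev_add ev_smult ev_pCons Suc.IH) simp
  also have "\<dots> = w ^ (CARD('a) ^ (n + (n * k + j)))"
    by (simp add: T_def frobenius_add power_mult_distrib frobenius_frobenius add.commute)
  also have "n + (n * k + j) = n * Suc k + j"
    by simp
  finally show ?case .
qed (simp add: newton_def ev_def)

lemma lead_coeff_newton: "lead_coeff (newton j k) = 1"
  by (simp add: newton_def lead_coeff_prod)

lemma degree_newton: "degree (newton j k) = k"
  by (simp add: newton_def degree_prod_eq_sum_degree)

subsection \<open>The polynomials inducing the operators\<close>

primrec T_poly :: "nat \<Rightarrow> 'a alg_closure poly" where
  "T_poly 0 = [:0, 1:]"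
| "T_poly (Suc k) = smult t (T_poly k) + T_poly k ^ (CARD('a) ^ n)"

lemma poly_T_poly: "poly (T_poly k) v = (T ^^ k) v"
  by (induction k) (simp_all add: T_def)

lemma q_pow_pos: "CARD('a) ^ i > 0"
  using zero_less_card_field[where 'a = 'a] by simp

lemma degree_T_poly_and_monic: "degree (T_poly k) = CARD('a) ^ (n * k) \<and> lead_coeff (T_poly k) = 1"
proof (induction k)
  case (Suc k)
  have "T_poly k \<noteq> 0" using Suc by auto
  then have d: "degree (T_poly k ^ (CARD('a) ^ n)) = CARD('a) ^ (n * Suc k)"
    using Suc by (simp add: degree_power_eq power_add)
  have "CARD('a) ^ (n * k) < CARD('a) ^ (n * Suc k)"
    using n_pos two_le_card_field[where 'a = 'a] by (intro power_strict_increasing) auto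
  then have l: "degree (smult t (T_poly k)) < degree (T_poly k ^ (CARD('a) ^ n))"
    unfolding d using Suc degree_smult_le[of t "T_poly k"] by linarith
  have "coeff (T_poly k ^ (CARD('a) ^ n)) (CARD('a) ^ (n * Suc k)) = 1"
    using lead_coeff_power[of "T_poly k" "CARD('a) ^ n"] unfolding d Suc[THEN conjunct2] by simp
  moreover have "coeff (smult t (T_poly k)) (CARD('a) ^ (n * Suc k)) = 0"
    using l unfolding d by (rule coeff_eq_0)
  ultimately show ?case
    using degree_add_eq_right[OF l] unfolding T_poly.simps d by (simp only: coeff_add add_0_left simp_thms)
qed simp

lemmas degree_T_poly = degree_T_poly_and_monic[THEN conjunct1]
lemmas lead_coeff_T_poly = degree_T_poly_and_monic[THEN conjunct2]

text \<open>
All the \<open>q^n\<close>-th powers in the recursion have derivative \<open>0\<close>.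
\<close>

lemma pderiv_T_poly: "pderiv (T_poly k) = [:t ^ k:]"
proof (induction k)
  case (Suc k)
  have "of_nat (CARD('a) ^ n) = (0 :: 'a alg_closure)"
    using n_pos by (simp add: of_nat_card_alg_closure)
  then have "pderiv (T_poly k ^ (CARD('a) ^ n)) = 0"
    by (simp only: pderiv_power smult_0_left)
  then show ?case using Suc by (simp add: pderiv_add pderiv_smult)
qed (simp add: pderiv_pCons)

text \<open>
The polynomial that induces \<open>act p\<close> has the constant derivative \<open>p(t)\<close>, so it is separable.
\<close>

lemma card_act_kernel:
  assumes p: "lead_coeff p = 1" and pt: "poly (map_poly to_ac p) t \<noteq> 0"
  shows "card {v. act p v = 0} = CARD('a) ^ (n * degree p)"
    and "finite {v. act p v = 0}"
proof -
  let ?d = "degree p"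
  define P where "P = (\<Sum>k\<le>?d. smult (to_ac (coeff p k)) (T_poly k))"
  have poly: "poly P v = act p v" for v
    by (simp add: P_def poly_sum poly_T_poly ev_def coeff_map_poly)
  have "pderiv P = (\<Sum>k\<le>?d. [:to_ac (coeff p k) * t ^ k:])"
    by (simp add: P_def higher_pderiv_sum[of 1, simplified] pderiv_smult pderiv_T_poly)
  also have "\<dots> = [:\<Sum>k\<le>?d. to_ac (coeff p k) * t ^ k:]"
    by (rule poly_eqI) (auto simp: coeff_sum coeff_pCons split: nat.splits)
  also have "\<dots> = [:poly (map_poly to_ac p) t:]"
    by (simp add: poly_altdef coeff_map_poly)
  finally have card: "card {v. poly P v = 0} = degree P"
    using pt by (rule card_roots_separable)
  have P: "P = (\<Sum>k<?d. smult (to_ac (coeff p k)) (T_poly k)) + T_poly ?d"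
    using p by (simp add: P_def lessThan_Suc_atMost[symmetric])
  have "degree (\<Sum>k<?d. smult (to_ac (coeff p k)) (T_poly k)) < degree (T_poly ?d)"
  proof (rule degree_sum_less)
    show "degree (smult (to_ac (coeff p k)) (T_poly k)) < degree (T_poly ?d)" if "k \<in> {..<?d}" for k
    proof -
      have "CARD('a) ^ (n * k) < CARD('a) ^ (n * ?d)"
        using n_pos two_le_card_field[where 'a = 'a] that by (intro power_strict_increasing) auto
      then show ?thesis
        using degree_smult_le[of "to_ac (coeff p k)" "T_poly k"] by (simp add: degree_T_poly)
    qed
  qed (simp add: degree_T_poly q_pow_pos)
  then have deg: "degree P = CARD('a) ^ (n * ?d)"
    unfolding P by (simp add: degree_add_eq_right degree_T_poly)
  show "card {v. act p v = 0} = CARD('a) ^ (n * degree p)"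
    using card deg by (simp add: poly)
  then show "finite {v. act p v = 0}"
    using q_pow_pos card.infinite by fastforce
qed

text \<open>
The operators \<open>ev F j\<close> for \<open>j < n\<close> are independent modulo \<open>p\<close> on the \<open>p\<close>-torsion. Behind it
is the fact that the twisted polynomials are a free module with basis \<open>\<tau>^0, ..., \<tau>^(n - 1)\<close> over the
ordinary polynomials, constants acting from the left and the variable as \<open>T\<close> from the right. The
reduction modulo \<open>p\<close> makes the degree small enough for counting zeros.
\<close>

lemma ev_vanish_dvd:
  fixes p :: "'a poly"
  assumes p: "lead_coeff p = 1" and pt: "poly (map_poly to_ac p) t \<noteq> 0"
    and I: "finite I" "inj_on j I" "\<And>i. i \<in> I \<Longrightarrow> j i < n"
    and vanish: "\<And>v. act p v = 0 \<Longrightarrow> (\<Sum>i\<in>I. ev (F i) (j i) v) = 0"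
    and "i \<in> I"
  shows "map_poly to_ac p dvd F i"
proof -
  let ?p = "map_poly to_ac p" and ?d = "degree p"
  define R where "R i = F i mod ?p" for i
  have p0: "?p \<noteq> 0" using p by auto
  have R: "ev (F i) (j i) v = ev (R i) (j i) v" if "act p v = 0" for i v
  proof -
    have "F i = (F i div ?p) * ?p + R i"
      by (simp only: R_def div_mult_mod_eq)
    then have "ev (F i) (j i) v = ev ((F i div ?p) * ?p) (j i) v + ev (R i) (j i) v"
      by (metis ev_add)
    then show ?thesis
      using that by (simp flip: ev_act)
  qed
  have van: "(\<Sum>i\<in>I. ev (R i) (j i) v) = 0" if "act p v = 0" for v
    using vanish[OF that] by (simp add: R[OF that])
  have dR: "coeff (R i) k = 0" if "k \<ge> ?d" for i k
    using that degree_mod_less[OF p0, of "F i"] by (auto simp: R_def coeff_eq_0)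
  \<comment> \<open>The operator induced by the reduced polynomials is a combination of monic polynomials whose degrees \<open>q^(n k + j)\<close> are pairwise different.\<close>
  define K where "K = I \<times> {..<?d}"
  define P where "P = (\<lambda>(i, k). T_poly k ^ (CARD('a) ^ j i))"
  define c where "c = (\<lambda>(i, k). coeff (R i) k)"
  define S where "S = (\<Sum>x\<in>K. smult (c x) (P x))"
  have degP: "degree (P (i, k)) = CARD('a) ^ (n * k + j i)" "lead_coeff (P (i, k)) = 1" for i k
  proof -
    have "T_poly k \<noteq> 0" using lead_coeff_T_poly[of k] by auto
    then show "degree (P (i, k)) = CARD('a) ^ (n * k + j i)"
      by (simp add: P_def degree_power_eq degree_T_poly power_add mult.commute)
    show "lead_coeff (P (i, k)) = 1"
      unfolding P_def prod.case lead_coeff_power lead_coeff_T_poly by (rule power_one)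
  qed
  have ev_lt: "ev (R i) (j i) v = (\<Sum>k<?d. coeff (R i) k * ((T ^^ k) v) ^ (CARD('a) ^ j i))" for i v
  proof (cases "?d = 0")
    case True
    then have "R i = 0" using dR by (intro poly_eqI) auto
    then show ?thesis using True by simp
  next
    case False
    have "degree (R i) \<le> ?d - 1"
      using dR by (intro degree_le) auto
    then show ?thesis
      using False by (simp add: ev_atMost[of _ "?d - 1"] lessThan_Suc_atMost[symmetric])
  qed
  have polyS: "poly S v = (\<Sum>i\<in>I. ev (R i) (j i) v)" for v
    by (simp add: S_def K_def P_def c_def poly_sum ev_lt poly_T_poly sum.cartesian_product
        split_def)
  have "S = 0"
  proof (rule ccontr)
    assume "S \<noteq> 0"
    have "CARD('a) ^ (n * ?d) = card {v. act p v = 0}"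
      using card_act_kernel(1)[OF p pt] by simp
    also have "\<dots> \<le> card {v. poly S v = 0}"
      using van polyS poly_roots_finite[OF \<open>S \<noteq> 0\<close>] by (intro card_mono) auto
    also have "\<dots> \<le> degree S"
      by (rule card_poly_roots_bound) fact
    also have "degree S < CARD('a) ^ (n * ?d)"
      unfolding S_def
    proof (rule degree_sum_less)
      fix x assume "x \<in> K"
      then obtain i k where x: "x = (i, k)" "i \<in> I" "k < ?d"
        by (auto simp: K_def)
      have "n * k + j i < n * Suc k" using I(3)[OF x(2)] by simp
      also have "\<dots> \<le> n * ?d" using x by (intro mult_le_mono2) simp
      finally have "CARD('a) ^ (n * k + j i) < CARD('a) ^ (n * ?d)"
        using two_le_card_field[where 'a = 'a] by (intro power_strict_increasing) auto
      then show "degree (smult (c x) (P x)) < CARD('a) ^ (n * ?d)"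
        using degree_smult_le[of "c x" "P x"] by (simp add: x degP)
    qed (rule q_pow_pos)
    finally show False by simp
  qed
  have inj: "inj_on (\<lambda>x. degree (P x)) K"
  proof (rule inj_onI)
    fix x y assume xy: "x \<in> K" "y \<in> K" "degree (P x) = degree (P y)"
    obtain i k where x: "x = (i, k)" "i \<in> I" "k < ?d" using xy by (auto simp: K_def)
    obtain i' k' where y: "y = (i', k')" "i' \<in> I" "k' < ?d" using xy by (auto simp: K_def)
    have *: "n * k + j i = n * k' + j i'"
      using xy(3) two_le_card_field[where 'a = 'a] unfolding x y degP
      by (subst (asm) power_inject_exp) auto
    then have "(n * k + j i) mod n = (n * k' + j i') mod n" by simp
    then have "j i = j i'"
      using I(3)[OF x(2)] I(3)[OF y(2)] by simp
    with * show "x = y"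
      using x y I(2) n_pos by (auto simp: inj_on_def)
  qed
  have "coeff (R i) k = 0" for k
  proof (cases "k < ?d")
    case True
    have "c (i, k) = 0"
    proof (rule sum_monic_distinct_degrees_eq_0[OF _ inj])
      show "finite K" using I by (simp add: K_def)
      show "(\<Sum>x\<in>K. smult (c x) (P x)) = 0" using \<open>S = 0\<close> by (simp add: S_def)
      show "(i, k) \<in> K" using True \<open>i \<in> I\<close> by (simp add: K_def)
      show "lead_coeff (P x) = 1" if "x \<in> K" for x
        using that degP(2) by (cases x) auto
    qed
    then show ?thesis by (simp add: c_def)
  qed (simp add: dR)
  then have "R i = 0" by (intro poly_eqI) simp
  then show ?thesis by (simp add: R_def mod_eq_0_iff_dvd)
qed

end

locale drinfeld_setting = drinfeld_operator n t
  for n :: nat and t :: "'a :: finite_field alg_closure" +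
  fixes p0 p :: "'a poly"
  assumes p0: "lead_coeff p0 = 1" "irreducible p0"
    and p: "lead_coeff p = 1" "irreducible p" "p \<noteq> p0"
    and coprime_degree: "gcd n (degree p0) = 1"
    and t_fixed: "t ^ (CARD('a) ^ degree p0) = t" and t_root: "poly (map_poly to_ac p0) t = 0"
begin

abbreviation r :: nat where "r \<equiv> degree p0"

lemma not_dvd_p0: "\<not> p dvd p0"
proof
  assume "p dvd p0"
  then obtain u where u: "p0 = p * u" by (elim dvdE)
  then have "is_unit u"
    using p0(2) p(2) by (metis irreducible_def)
  moreover have "lead_coeff u = 1"
    using p0(1) p(1) by (simp add: u lead_coeff_mult)
  ultimately have "u = 1"
    by (metis is_unit_poly_iff lead_coeff_pCons(1) lead_coeff_1 one_pCons poly_eq_iff degree_pCons_0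
        coeff_pCons_0)
  then show False using u p(3) by simp
qed

lemma frobenius_root: "poly (map_poly to_ac p0) (t ^ (CARD('a) ^ m)) = 0"
proof -
  have "poly (map_poly to_ac p0) (t ^ (CARD('a) ^ m)) = (poly (map_poly to_ac p0) t) ^ (CARD('a) ^ m)"
    by (simp add: poly_altdef frobenius_sum coeff_map_poly power_mult_distrib
        flip: power_mult) (simp add: mult.commute)
  then show ?thesis by (simp add: t_root)
qed

lemma p_no_root: "poly (map_poly to_ac p) (t ^ (CARD('a) ^ m)) \<noteq> 0"
  using irreducible_no_common_root[OF p(2) not_dvd_p0] frobenius_root by blast

lemma p_no_root_t: "poly (map_poly to_ac p) t \<noteq> 0"
  using p_no_root[of 0] by simp

text \<open>
This is where the coprimality of \<open>n\<close> and \<open>r\<close> enters for the first time: a coincidence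
\<open>t^(q^(n l)) = t^(q^(n l'))\<close> makes \<open>n (l' - l)\<close> a multiple of \<open>r\<close>.
\<close>

lemma conjugates_inj: "inj_on (\<lambda>l. t ^ (CARD('a) ^ (n * l))) {..<r}"
proof -
  have "False" if "l < l'" "l' < r" and eq: "t ^ (CARD('a) ^ (n * l)) = t ^ (CARD('a) ^ (n * l'))" for l l'
  proof -
    have "n * l' = n * (l' - l) + n * l"
      using that by (simp flip: add_mult_distrib2)
    then have "(t ^ (CARD('a) ^ (n * (l' - l)))) ^ (CARD('a) ^ (n * l)) = t ^ (CARD('a) ^ (n * l))"
      by (simp add: frobenius_frobenius eq)
    then have "t ^ (CARD('a) ^ (n * (l' - l))) = t"
      by (simp add: frobenius_inj)
    then have "r dvd n * (l' - l)"
      by (rule root_period_multiple_of_degree[OF p0(2) t_root t_fixed])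
    then have "r dvd l' - l"
      using coprime_degree by (metis coprime_dvd_mult_right_iff coprime_iff_gcd_eq_1 gcd.commute)
    then show False
      using that dvd_imp_le[of r "l' - l"] by simp
  qed
  then show ?thesis
    by (metis (mono_tags, lifting) inj_onI lessThan_iff nat_neq_iff)
qed

lemma newton_eq_p0: "newton 0 r = map_poly to_ac p0"
proof -
  have "newton 0 r dvd map_poly to_ac p0"
    unfolding newton_def using conjugates_inj frobenius_root
    by (intro prod_linear_factors_dvd) auto
  then obtain u where u: "map_poly to_ac p0 = newton 0 r * u" by (elim dvdE)
  have "u \<noteq> 0" "newton 0 r \<noteq> 0" using u p0 by auto
  then have "degree u = 0"
    using arg_cong[OF u, of degree] by (simp add: degree_mult_eq degree_newton)
  moreover have "lead_coeff u = 1"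
    using arg_cong[OF u, of lead_coeff] p0(1) by (simp add: lead_coeff_mult lead_coeff_newton coeff_map_poly)
  ultimately have "u = 1"
    by (metis degree_eq_zeroE lead_coeff_pCons(1) one_pCons degree_pCons_0 coeff_pCons_0)
  then show ?thesis using u by simp
qed

lemma act_p0: "act p0 v = v ^ (CARD('a) ^ (n * r))"
  using ev_newton[of 0 r v] by (simp add: newton_eq_p0)

text \<open>
Each \<open>\<tau>^(r i)\<close> is split as \<open>\<tau>^(n k + j)\<close> with \<open>j < n\<close>. Newton interpolation turns \<open>\<tau>^(n k)\<close> into a
polynomial in \<open>T\<close> that has only conjugates of \<open>t\<close> as roots; these are prime to \<open>p\<close>. What remains are
the \<open>\<tau>^j\<close>, whose exponents \<open>r i mod n\<close> are pairwise different, so \<open>ev_vanish_dvd\<close> applies.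
\<close>

lemma frobenius_powers_independent:
  assumes "\<And>v. act p v = 0 \<Longrightarrow> (\<Sum>i<n. act (a i) (v ^ (CARD('a) ^ (r * i)))) = 0" and "i < n"
  shows "p dvd a i"
proof -
  define j where "j i = (r * i) mod n" for i
  define k where "k i = (r * i) div n" for i
  define F where "F i = newton (j i) (k i) * map_poly to_ac (a i)" for i
  have eq: "act (a i) (v ^ (CARD('a) ^ (r * i))) = ev (F i) (j i) v" for i v
  proof -
    have "act (a i) (v ^ (CARD('a) ^ (r * i))) = act (a i) v ^ (CARD('a) ^ (r * i))"
      by (rule act_frobenius) (rule frobenius_fixed_mult[OF t_fixed])
    also have "\<dots> = act (a i) v ^ (CARD('a) ^ (n * k i + j i))"
      by (simp add: j_def k_def)
    also have "\<dots> = ev (newton (j i) (k i)) (j i) (act (a i) v)"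
      by (simp add: ev_newton)
    also have "\<dots> = ev (F i) (j i) v"
      by (simp add: ev_act F_def)
    finally show ?thesis .
  qed
  have "inj_on j {..<n}"
  proof -
    have False if "x < y" "y < n" and eq: "j x = j y" for x y
    proof -
      have "n dvd r * y - r * x"
        using eq that mod_eq_dvd_iff_nat[of "r * x" "r * y" n] by (simp add: j_def)
      then have "n dvd r * (y - x)"
        by (simp add: diff_mult_distrib2)
      then have "n dvd y - x"
        using coprime_degree by (metis coprime_dvd_mult_right_iff coprime_iff_gcd_eq_1)
      then show False
        using that dvd_imp_le[of n "y - x"] by simp
    qed
    then show ?thesis
      by (metis (mono_tags, lifting) inj_onI lessThan_iff nat_neq_iff)
  qed
  then have "map_poly to_ac p dvd F i"
    using assms n_pos
    by (intro ev_vanish_dvd[OF p(1) p_no_root_t, of "{..<n}" j]) (auto simp: j_def eq)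
  then have "map_poly to_ac p dvd map_poly to_ac (a i)"
    unfolding F_def newton_def
    by (rule dvd_cancel_linear_factors) (rule p_no_root)
  then show ?thesis by (simp add: poly_to_ac_dvd_iff)
qed

end

section \<open>Cayley-Hamilton for an operator on a module\<close>

text \<open>
An endomorphism \<open>f\<close> of a module over a commutative ring makes it a module over polynomials, with the
variable acting as \<open>f\<close>; \<open>peval\<close> below is that action. The scalars will be \<open>A\<close> itself: matrices over
the residue field are treated by lifting their entries.
\<close>

locale module_endomorphism =
  fixes scale :: "'r :: comm_ring_1 \<Rightarrow> 'v :: ab_group_add \<Rightarrow> 'v" and f :: "'v \<Rightarrow> 'v"
  assumes scale_add: "scale (a + b) v = scale a v + scale b v"
    and scale_add_right: "scale a (v + w) = scale a v + scale a w"
    and scale_mult: "scale (a * b) v = scale a (scale b v)"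
    and scale_1: "scale 1 v = v"
    and f_add: "f (v + w) = f v + f w"
    and f_scale: "f (scale a v) = scale a (f v)"
begin

lemma scale_0 [simp]: "scale 0 v = 0"
  using scale_add[of 0 0 v] by simp

lemma scale_0_right [simp]: "scale a 0 = 0"
  using scale_add_right[of a 0 0] by simp

lemma scale_sum_right: "scale a (\<Sum>x\<in>A. v x) = (\<Sum>x\<in>A. scale a (v x))"
  by (induction A rule: infinite_finite_induct) (simp_all add: scale_add_right)

lemma f_0 [simp]: "f 0 = 0"
  using f_add[of 0 0] by simp

lemma funpow_add_right: "(f ^^ k) (v + w) = (f ^^ k) v + (f ^^ k) w"
  by (induction k) (simp_all add: f_add)

lemma funpow_0_right [simp]: "(f ^^ k) 0 = 0"
  by (induction k) simp_all

lemma funpow_scale: "(f ^^ k) (scale a v) = scale a ((f ^^ k) v)"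
  by (induction k) (simp_all add: f_scale)

definition peval :: "'r poly \<Rightarrow> 'v \<Rightarrow> 'v" where
  "peval g v = (\<Sum>k\<le>degree g. scale (coeff g k) ((f ^^ k) v))"

lemma peval_atMost: "degree g \<le> N \<Longrightarrow> peval g v = (\<Sum>k\<le>N. scale (coeff g k) ((f ^^ k) v))"
  unfolding peval_def by (rule sum.mono_neutral_left) (auto simp: coeff_eq_0)

lemma peval_add: "peval (g + h) v = peval g v + peval h v"
proof -
  let ?N = "max (degree g) (degree h)"
  have "degree (g + h) \<le> ?N" by (rule degree_add_le_max)
  then show ?thesis
    by (simp add: peval_atMost[of _ ?N] sum.distrib scale_add)
qed

lemma peval_0 [simp]: "peval 0 v = 0"
  by (simp add: peval_def)

lemma peval_sum: "peval (\<Sum>x\<in>A. g x) v = (\<Sum>x\<in>A. peval (g x) v)"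
  by (induction A rule: infinite_finite_induct) (simp_all add: peval_add)

lemma peval_add_right: "peval g (v + w) = peval g v + peval g w"
  by (simp add: peval_def funpow_add_right scale_add_right sum.distrib)

lemma peval_0_right [simp]: "peval g 0 = 0"
  by (simp add: peval_def)

lemma peval_sum_right: "peval g (\<Sum>x\<in>A. v x) = (\<Sum>x\<in>A. peval g (v x))"
  by (induction A rule: infinite_finite_induct) (simp_all add: peval_add_right)

lemma peval_scale: "peval g (scale a v) = scale a (peval g v)"
  by (simp add: peval_def funpow_scale scale_sum_right flip: scale_mult) (simp add: mult.commute)

lemma peval_smult: "peval (smult a g) v = scale a (peval g v)"
  using peval_atMost[of "smult a g" "degree g"]
  by (simp add: peval_def degree_smult_le scale_sum_right scale_mult)

lemma peval_pCons: "peval (pCons a g) v = scale a v + peval g (f v)"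
proof -
  have "peval (pCons a g) v = (\<Sum>k\<le>Suc (degree g). scale (coeff (pCons a g) k) ((f ^^ k) v))"
    by (rule peval_atMost) (rule degree_pCons_le)
  also have "\<dots> = scale a v + peval g (f v)"
    unfolding peval_def sum.atMost_Suc_shift by (simp add: funpow_swap1)
  finally show ?thesis .
qed

lemma peval_f: "peval g (f v) = f (peval g v)"
proof -
  have "f (\<Sum>x\<in>A. w x) = (\<Sum>x\<in>A. f (w x))" for A and w :: "nat \<Rightarrow> 'v"
    by (induction A rule: infinite_finite_induct) (simp_all add: f_add)
  then show ?thesis by (simp add: peval_def f_scale funpow_swap1)
qed

lemma peval_mult: "peval (g * h) v = peval g (peval h v)"
proof (induction g arbitrary: v)
  case (pCons a g)
  have "peval (pCons a g * h) v = scale a (peval h v) + peval (g * h) (f v)"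
    by (simp add: peval_add peval_smult peval_pCons scale_1)
  also have "\<dots> = peval (pCons a g) (peval h v)"
    by (simp add: peval_pCons pCons.IH peval_f)
  finally show ?case .
qed simp

text \<open>
The determinant trick. Over polynomials, the matrix \<open>C = X - B\<close> kills the vector of generators \<open>b\<close>;
multiplication by the adjugate of \<open>C\<close> shows that \<open>det C\<close> kills each of them.
\<close>

theorem cayley_hamilton:
  fixes B :: "'r mat"
  assumes B: "B \<in> carrier_mat m m"
    and fb: "\<And>j. j < m \<Longrightarrow> f (b j) = (\<Sum>i<m. scale (B $$ (i, j)) (b i))"
    and l: "l < m"
  shows "peval (char_poly B) (b l) = 0"
proof -
  define C where "C = char_poly_matrix B"
  have C: "C \<in> carrier_mat m m" using B by (simp add: C_def)
  note adj = adj_mat[OF C]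
  have Cij: "C $$ (i, j) = (if i = j then [:0, 1:] else 0) + [:- (B $$ (i, j)):]"
    if "i < m" "j < m" for i j
    using that B by (auto simp: C_def char_poly_matrix_def)
  have zero: "(\<Sum>i<m. peval (C $$ (i, j)) (b i)) = 0" if j: "j < m" for j
  proof -
    have neg: "scale (- a) v = - scale a v" for a v
      using scale_add[of a "- a" v] by (simp add: add_eq_0_iff)
    have "(\<Sum>i<m. peval (C $$ (i, j)) (b i))
      = (\<Sum>i<m. (if i = j then f (b i) else 0) + - scale (B $$ (i, j)) (b i))"
      using j by (intro sum.cong) (auto simp: Cij peval_add peval_pCons scale_1 neg)
    also have "\<dots> = f (b j) - (\<Sum>i<m. scale (B $$ (i, j)) (b i))"
      unfolding sum.distrib sum_negf using j by simp
    finally show ?thesis using fb[OF j] by simp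
  qed
  have ent: "(\<Sum>j<m. C $$ (i, j) * adj_mat C $$ (j, l)) = (if i = l then char_poly B else 0)"
    if i: "i < m" for i
  proof -
    have "(C * adj_mat C) $$ (i, l) = (\<Sum>j<m. C $$ (i, j) * adj_mat C $$ (j, l))"
      using i l C adj(1) by (simp add: scalar_prod_def lessThan_atLeast0)
    then show ?thesis
      using i l unfolding adj(2)
      by (cases "i = l") (simp_all add: C_def char_poly_def)
  qed
  have "peval (char_poly B) (b l)
    = (\<Sum>i<m. peval (if i = l then char_poly B else 0) (b i))"
    using l by (simp add: if_distrib[of "\<lambda>x. peval x _"] sum.delta cong: if_cong)
  also have "\<dots> = (\<Sum>i<m. \<Sum>j<m. peval (adj_mat C $$ (j, l)) (peval (C $$ (i, j)) (b i)))"
    by (intro sum.cong refl) (simp add: peval_sum mult.commute flip: ent peval_mult)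
  also have "\<dots> = (\<Sum>j<m. peval (adj_mat C $$ (j, l)) (\<Sum>i<m. peval (C $$ (i, j)) (b i)))"
    by (subst sum.swap) (simp add: peval_sum_right)
  also have "\<dots> = 0" by (simp add: zero)
  finally show ?thesis .
qed

end

section \<open>Homomorphisms from a ring type to a ring record\<close>

lemma ring_of_type_simps:
  "carrier ring_of_type_algebra = UNIV"
  "x \<otimes>\<^bsub>ring_of_type_algebra\<^esub> y = x * y"
  "x \<oplus>\<^bsub>ring_of_type_algebra\<^esub> y = x + y"
  "\<one>\<^bsub>ring_of_type_algebra\<^esub> = 1"
  "\<zero>\<^bsub>ring_of_type_algebra\<^esub> = 0"
  by (simp_all add: ring_of_type_algebra_def)

text \<open>
Cayley-Hamilton was proved over a ring type, whereas \<open>mat_char_poly\<close> speaks about a ring given by a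
carrier, here the residue field. A homomorphism from the former to the latter transports
determinants and characteristic polynomials.
\<close>

locale type_ring_hom = R?: cring R for R :: "('k, 'm) ring_scheme" (structure) +
  fixes h :: "'r :: comm_ring_1 \<Rightarrow> 'k"
  assumes hom: "h \<in> Ring.ring_hom ring_of_type_algebra R"
begin

lemma hom_closed [simp]: "h x \<in> carrier R"
  using ring_hom_closed[OF hom, of x] by (simp add: ring_of_type_simps)

lemma hom_add: "h (x + y) = h x \<oplus> h y"
  using ring_hom_add[OF hom, of x y] by (simp add: ring_of_type_simps)

lemma hom_mult: "h (x * y) = h x \<otimes> h y"
  using ring_hom_mult[OF hom, of x y] by (simp add: ring_of_type_simps)

lemma hom_one: "h 1 = \<one>"
  using ring_hom_one[OF hom] by (simp add: ring_of_type_simps)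

lemma hom_zero: "h 0 = \<zero>"
  using ring_hom_zero[OF hom ring_from_type_algebra R.ring_axioms] by (simp add: ring_of_type_simps)

lemma hom_uminus: "h (- x) = \<ominus> h x"
  using hom_add[of x "- x"] by (simp add: hom_zero R.sum_zero_eq_neg R.add.m_comm)

lemma hom_diff: "h (x - y) = h x \<ominus> h y"
  using hom_add[of x "- y"] by (simp add: hom_uminus a_minus_def)

lemma hom_sum: "finite A \<Longrightarrow> h (\<Sum>x\<in>A. g x) = (\<Oplus>x\<in>A. h (g x))"
  by (induction A rule: finite_induct) (simp_all add: hom_zero hom_add)

lemma hom_prod: "finite A \<Longrightarrow> h (\<Prod>x\<in>A. g x) = (\<Otimes>x\<in>A. h (g x))"
  by (induction A rule: finite_induct) (simp_all add: hom_one hom_mult)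

definition coeffs_hom :: "'r poly \<Rightarrow> (nat \<Rightarrow> 'k)" where
  "coeffs_hom g = (\<lambda>i. h (Polynomial.coeff g i))"

lemma coeffs_hom_in_up: "coeffs_hom g \<in> up R"
proof
  show "\<exists>n. bound \<zero> n (coeffs_hom g)"
    by (intro exI[of _ "Polynomial.degree g"]) (auto simp: coeffs_hom_def coeff_eq_0 hom_zero)
qed (simp add: coeffs_hom_def)

lemma coeffs_hom_ring_hom: "coeffs_hom \<in> Ring.ring_hom ring_of_type_algebra (UP R)"
proof (rule ring_hom_memI)
  fix x y :: "'r poly"
  show "coeffs_hom x \<in> carrier (UP R)"
    using coeffs_hom_in_up by (simp add: UP_def)
  show "coeffs_hom (x \<otimes>\<^bsub>ring_of_type_algebra\<^esub> y) = coeffs_hom x \<otimes>\<^bsub>UP R\<^esub> coeffs_hom y"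
    by (simp add: UP_def coeffs_hom_in_up ring_of_type_simps)
       (simp add: coeffs_hom_def coeff_mult hom_sum hom_mult fun_eq_iff)
  show "coeffs_hom (x \<oplus>\<^bsub>ring_of_type_algebra\<^esub> y) = coeffs_hom x \<oplus>\<^bsub>UP R\<^esub> coeffs_hom y"
    by (simp add: UP_def coeffs_hom_in_up ring_of_type_simps)
       (simp add: coeffs_hom_def hom_add fun_eq_iff)
  show "coeffs_hom \<one>\<^bsub>ring_of_type_algebra\<^esub> = \<one>\<^bsub>UP R\<^esub>"
    by (auto simp add: UP_def ring_of_type_simps coeffs_hom_def hom_one hom_zero fun_eq_iff)
qed

interpretation UP: UP_cring R "UP R"
  by unfold_locales simp

interpretation PH: type_ring_hom "UP R" coeffs_hom
  by unfold_locales (rule coeffs_hom_ring_hom)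

lemma coeffs_hom_monom: "coeffs_hom (Polynomial.monom a k) = up_ring.monom (UP R) (h a) k"
  by (auto simp: coeffs_hom_def UP_def hom_zero fun_eq_iff)

lemma coeffs_hom_diff: "coeffs_hom (x - y) = coeffs_hom x \<ominus>\<^bsub>UP R\<^esub> coeffs_hom y"
  by (rule PH.hom_diff)

lemma ring_det_hom:
  assumes A: "A \<in> carrier_mat n n" and E: "\<And>i j. i < n \<Longrightarrow> j < n \<Longrightarrow> E i j = h (A $$ (i, j))"
  shows "ring_det R n E = h (det A)"
proof -
  have fin: "finite {\<sigma>. \<sigma> permutes {..<n}}"
    by (rule finite_permutations) simp
  have summand: "add_pow R (sign \<sigma>) (\<Otimes>i\<in>{..<n}. E i (\<sigma> i)) = h (signof \<sigma> * (\<Prod>i<n. A $$ (i, \<sigma> i)))"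
    if \<sigma>: "\<sigma> permutes {..<n}" for \<sigma>
  proof -
    have "(\<Otimes>i\<in>{..<n}. E i (\<sigma> i)) = (\<Otimes>i\<in>{..<n}. h (A $$ (i, \<sigma> i)))"
      using permutes_in_image[OF \<sigma>] by (intro R.finprod_cong') (auto simp: E)
    also have "\<dots> = h (\<Prod>i<n. A $$ (i, \<sigma> i))"
      by (simp add: hom_prod)
    finally have P: "(\<Otimes>i\<in>{..<n}. E i (\<sigma> i)) = h (\<Prod>i<n. A $$ (i, \<sigma> i))" .
    show ?thesis
      unfolding P by (cases \<sigma> rule: sign_cases) (simp_all add: hom_uminus add_pow_int_ge add_pow_int_lt)
  qed
  have "ring_det R n E = (\<Oplus>\<sigma>\<in>{\<sigma>. \<sigma> permutes {..<n}}. h (signof \<sigma> * (\<Prod>i<n. A $$ (i, \<sigma> i))))"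
    unfolding ring_det_def by (intro R.finsum_cong') (auto simp: summand)
  also have "\<dots> = h (det A)"
    using A by (simp add: det_def' lessThan_atLeast0 hom_sum[OF fin[unfolded lessThan_atLeast0]])
  finally show ?thesis .
qed

text \<open>
The characteristic polynomial is a determinant over polynomials, so this is \<open>ring_det_hom\<close> for the
homomorphism \<open>coeffs_hom\<close> induced on polynomials.
\<close>

lemma mat_char_poly_hom:
  assumes A: "A \<in> carrier_mat n n" and B: "\<And>i j. i < n \<Longrightarrow> j < n \<Longrightarrow> B i j = h (A $$ (i, j))"
  shows "mat_char_poly R n B = coeffs_hom (char_poly A)"
  unfolding mat_char_poly_def char_poly_def
proof (rule type_ring_hom.ring_det_hom[OF PH.type_ring_hom_axioms])
  show "char_poly_matrix A \<in> carrier_mat n n" using A by simp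
  fix i j assume ij: "i < n" "j < n"
  have "char_poly_matrix A $$ (i, j) = (if i = j then Polynomial.monom 1 1 else 0) - Polynomial.monom (A $$ (i, j)) 0"
    using A ij by (auto simp: char_poly_matrix_def monom_0 monom_Suc)
  then have "coeffs_hom (char_poly_matrix A $$ (i, j))
    = coeffs_hom (if i = j then Polynomial.monom 1 1 else 0) \<ominus>\<^bsub>UP R\<^esub> coeffs_hom (Polynomial.monom (A $$ (i, j)) 0)"
    by (simp add: PH.hom_diff)
  then show "(if i = j then up_ring.monom (UP R) \<one> 1 else \<zero>\<^bsub>UP R\<^esub>)
      \<ominus>\<^bsub>UP R\<^esub> up_ring.monom (UP R) (B i j) 0 = coeffs_hom (char_poly_matrix A $$ (i, j))"
    using ij by (simp add: coeffs_hom_monom B hom_one PH.hom_zero)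
qed

end

section \<open>The residue field\<close>

abbreviation residue :: "'a :: finite_field poly \<Rightarrow> 'a poly \<Rightarrow> 'a poly set" where
  "residue p a \<equiv> PIdl\<^bsub>poly_A\<^esub> p +>\<^bsub>poly_A\<^esub> a"

lemma mem_residue_iff: "x \<in> residue p a \<longleftrightarrow> p dvd x - a"
proof -
  have "x \<in> residue p a \<longleftrightarrow> (\<exists>u. x = u * p + a)"
    by (auto simp: a_r_coset_def' cgenideal_def ring_of_type_simps)
  also have "\<dots> \<longleftrightarrow> p dvd x - a"
    by (auto simp: dvd_def diff_eq_eq mult.commute)
  finally show ?thesis .
qed

lemma residue_eq_iff: "residue p a = residue p b \<longleftrightarrow> p dvd a - b"
proof
  assume "residue p a = residue p b"
  then show "p dvd a - b" using mem_residue_iff[of a p a] mem_residue_iff[of a p b] by simp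
next
  assume *: "p dvd a - b"
  have "p dvd x - a \<longleftrightarrow> p dvd x - b" for x
    using dvd_add_left_iff[OF *, of "x - a"] by simp
  then show "residue p a = residue p b" by (auto simp: mem_residue_iff)
qed

lemma some_residue: "p dvd (SOME x. x \<in> residue p a) - a"
  using someI[of "\<lambda>x. x \<in> residue p a" a] by (simp add: mem_residue_iff)

lemma ideal_poly: "ideal (PIdl\<^bsub>poly_A\<^esub> p) poly_A"
  by (rule cring.cgenideal_ideal) (auto simp: ring_of_type_simps)

lemma carrier_residue_class_ring: "carrier (residue_class_ring p) = range (residue p)"
  by (auto simp: residue_class_ring_def FactRing_def A_RCOSETS_def' ring_of_type_simps)

lemma cring_residue_class_ring: "cring (residue_class_ring p)"
  unfolding residue_class_ring_def
  by (rule ideal.quotient_is_cring[OF ideal_poly]) auto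

interpretation residue_hom: type_ring_hom "residue_class_ring p" "residue p"
  unfolding type_ring_hom_def type_ring_hom_axioms_def
  using cring_residue_class_ring ideal.rcos_ring_hom[OF ideal_poly]
  by (auto simp: residue_class_ring_def)

lemma residue_eq_zero_iff: "residue p a = \<zero>\<^bsub>residue_class_ring p\<^esub> \<longleftrightarrow> p dvd a"
  using residue_eq_iff[of p a 0] by (simp add: residue_hom.hom_zero)

text \<open>
A Bezout identity \<open>u a + w p = 1\<close> shows that \<open>u\<close> is an inverse of \<open>a\<close> modulo \<open>p\<close>.
\<close>

lemma residue_unit:
  assumes "irreducible p" "\<not> p dvd a"
  shows "residue p a \<in> Units (residue_class_ring p)"
proof -
  obtain u w where "u * a + w * p = 1"
    using irreducible_bezout[OF assms] by blast
  then have "p dvd u * a - 1"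
    by (metis add_diff_cancel_left' diff_add_cancel dvd_minus_iff dvd_triv_right minus_diff_eq)
  then have "residue p (u * a) = residue p 1" by (simp add: residue_eq_iff)
  then have "residue p u \<otimes>\<^bsub>residue_class_ring p\<^esub> residue p a = \<one>\<^bsub>residue_class_ring p\<^esub>"
    by (simp add: residue_hom.hom_mult residue_hom.hom_one)
  moreover from this have "residue p a \<otimes>\<^bsub>residue_class_ring p\<^esub> residue p u = \<one>\<^bsub>residue_class_ring p\<^esub>"
    by (simp flip: residue_hom.hom_mult add: mult.commute)
  ultimately show ?thesis
    by (auto simp: Units_def)
qed

lemma field_residue_class_ring:
  assumes "irreducible p"
  shows "field (residue_class_ring p)"
proof (rule cring.cring_fieldI[OF cring_residue_class_ring])
  let ?K = "residue_class_ring p"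
  have "\<not> p dvd 1" using assms by (auto simp: irreducible_def)
  then have ne: "\<one>\<^bsub>?K\<^esub> \<noteq> \<zero>\<^bsub>?K\<^esub>"
    using residue_eq_zero_iff[of p 1] by (simp add: residue_hom.hom_one)
  show "Units ?K = carrier ?K - {\<zero>\<^bsub>?K\<^esub>}"
  proof (intro equalityI subsetI)
    fix x assume "x \<in> Units ?K"
    then show "x \<in> carrier ?K - {\<zero>\<^bsub>?K\<^esub>}"
      using ne by (auto simp: Units_def)
  next
    fix x assume "x \<in> carrier ?K - {\<zero>\<^bsub>?K\<^esub>}"
    then obtain a where "x = residue p a" "x \<noteq> \<zero>\<^bsub>?K\<^esub>"
      unfolding carrier_residue_class_ring by blast
    then have "x = residue p a" "\<not> p dvd a"
      using residue_eq_zero_iff[of p a] by simp_all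
    then show "x \<in> Units ?K" using residue_unit[OF assms] by simp
  qed
qed

text \<open>
Every class has exactly one representative of degree less than that of \<open>p\<close>.
\<close>

lemma card_residue_class_ring:
  fixes p :: "'a :: finite_field poly"
  assumes "irreducible p"
  shows "card (carrier (residue_class_ring p)) = CARD('a) ^ degree p"
proof -
  have p: "p \<noteq> 0" "degree p > 0"
    using assms by (auto simp: irreducible_def is_unit_iff_degree)
  have "bij_betw (residue p) {a. degree a < degree p} (carrier (residue_class_ring p))"
    unfolding bij_betw_def carrier_residue_class_ring
  proof
    show "inj_on (residue p) {a. degree a < degree p}"
    proof (rule inj_onI)
      fix a b assume ab: "a \<in> {a. degree a < degree p}" "b \<in> {a. degree a < degree p}"
        "residue p a = residue p b"
      then have "degree (a - b) < degree p" by (auto intro: degree_diff_less)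
      moreover have "p dvd a - b" using ab residue_eq_iff by blast
      ultimately show "a = b"
        using dvd_imp_degree_le[of p "a - b"] by fastforce
    qed
    have "residue p a \<in> residue p ` {a. degree a < degree p}" for a
    proof
      show "residue p a = residue p (a mod p)"
        by (simp add: residue_eq_iff minus_mod_eq_mult_div)
      show "a mod p \<in> {a. degree a < degree p}"
        using p degree_mod_less[of p a] by auto
    qed
    then show "residue p ` {a. degree a < degree p} = range (residue p)" by auto
  qed
  from bij_betw_same_card[OF this] show ?thesis
    using card_polys_degree_less[OF p(2), where 'a = 'a] by simp
qed

section \<open>Twisted polynomials acting on the algebraic closure\<close>

lemma twisted_act_atMost:
  "degree f \<le> N \<Longrightarrow>
    twisted_act (f :: 'a :: finite_field alg_closure poly) v = (\<Sum>i\<le>N. coeff f i * v ^ (CARD('a) ^ i))"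
  unfolding twisted_act_def by (rule sum.mono_neutral_left) (auto simp: coeff_eq_0)

lemma twisted_act_add: "twisted_act (f + g) v = twisted_act f v + twisted_act g v"
proof -
  let ?N = "max (degree f) (degree g)"
  have "degree (f + g) \<le> ?N" by (rule degree_add_le_max)
  then show ?thesis
    by (simp add: twisted_act_atMost[of _ ?N] sum.distrib algebra_simps)
qed

lemma twisted_act_0 [simp]: "twisted_act 0 v = 0"
  by (simp add: twisted_act_def)

lemma twisted_act_sum: "twisted_act (\<Sum>x\<in>A. f x) v = (\<Sum>x\<in>A. twisted_act (f x) v)"
  by (induction A rule: infinite_finite_induct) (simp_all add: twisted_act_add)

lemma twisted_act_monom:
  "twisted_act (monom c k :: 'a :: finite_field alg_closure poly) v = c * v ^ (CARD('a) ^ k)"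
  using twisted_act_atMost[of "monom c k" k v]
  by (simp add: degree_monom_le if_distrib[of "\<lambda>x. x * _"] cong: if_cong)

lemma twisted_act_mult: "twisted_act (twisted_mult f g) v = twisted_act f (twisted_act g v)"
  unfolding twisted_mult_def twisted_act_sum twisted_act_monom
  by (simp add: twisted_act_def frobenius_sum power_mult_distrib frobenius_frobenius
      sum_distrib_left add.commute mult.assoc)

lemma twisted_act_tau_pow:
  "twisted_act (tau_pow k) v = (v :: 'a :: finite_field alg_closure) ^ (CARD('a) ^ k)"
  by (simp add: tau_pow_def twisted_act_monom)

lemma twisted_act_const: "twisted_act (twisted_const c) v = c * v"
  using twisted_act_monom[of c 0 v] by (simp add: twisted_const_def monom_0)

lemma twisted_act_tau_pow_power:
  fixes v :: "'a :: finite_field alg_closure"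
  shows "twisted_act (tau_pow r [^]\<^bsub>twisted_poly_ring s\<^esub> k) v = v ^ (CARD('a) ^ (r * k))"
proof (induction k arbitrary: v)
  case 0
  have "twisted_act 1 v = v"
    using twisted_act_monom[of 1 0 v] by (simp add: monom_0 one_pCons)
  then show ?case by (simp add: nat_pow_def twisted_poly_ring_def)
next
  case (Suc k)
  have "(tau_pow r :: 'a alg_closure poly) [^]\<^bsub>twisted_poly_ring s\<^esub> Suc k
      = twisted_mult (tau_pow r [^]\<^bsub>twisted_poly_ring s\<^esub> k) (tau_pow r)"
    by (simp add: nat_pow_def twisted_poly_ring_def)
  then have "twisted_act (tau_pow r [^]\<^bsub>twisted_poly_ring s\<^esub> Suc k) v
      = twisted_act (tau_pow r [^]\<^bsub>twisted_poly_ring s\<^esub> k) (twisted_act (tau_pow r) v)"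
    by (simp only: twisted_act_mult)
  also have "\<dots> = v ^ (CARD('a) ^ (r * Suc k))"
    by (simp add: Suc.IH twisted_act_tau_pow frobenius_frobenius)
  finally show ?case .
qed

text \<open>
A Drinfeld module is determined by its values at constants and at the variable. The induction peels
the variable off on the right, \<open>a = c + a' X\<close>, since \<open>ev\<close> also applies \<open>T\<close> first.
\<close>

lemma (in drinfeld_operator) twisted_act_drinfeld_module:
  assumes "drinfeld_module r n t \<phi>"
  shows "twisted_act (\<phi> a) v = act a v"
proof -
  have hom: "\<phi> \<in> Ring.ring_hom poly_A (twisted_poly_ring r)"
    and const: "\<phi> [:c:] = twisted_const (to_ac c)" and T: "\<phi> [:0, 1:] = twisted_const t + tau_pow n" for c
    using assms by (auto simp: drinfeld_module_def)
  have add: "\<phi> (x + y) = \<phi> x + \<phi> y" and mult: "\<phi> (x * y) = twisted_mult (\<phi> x) (\<phi> y)" for x y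
    using ring_hom_add[OF hom, of x y] ring_hom_mult[OF hom, of x y]
    by (simp_all add: ring_of_type_simps, simp_all add: twisted_poly_ring_def)
  show ?thesis
  proof (induction a arbitrary: v)
    case 0
    then show ?case using const[of 0] by (simp add: twisted_act_const)
  next
    case (pCons c a)
    have "pCons c a = [:c:] + a * [:0, 1:]" by simp
    then have "\<phi> (pCons c a) = twisted_const (to_ac c) + twisted_mult (\<phi> a) (twisted_const t + tau_pow n)"
      by (metis add mult const T)
    then have "twisted_act (\<phi> (pCons c a)) v = to_ac c * v + act a (T v)"
      by (simp add: twisted_act_add twisted_act_const twisted_act_mult twisted_act_tau_pow pCons.IH T_def)
    then show ?case using pCons.hyps by (simp add: map_poly_pCons ev_pCons)
  qed
qed

section \<open>The torsion module\<close>

lemma (in vectorspace) card_carrier_basis: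
  assumes "finite S" "basis S"
  shows "card (carrier V) = card (carrier K) ^ card S"
proof -
  have S: "S \<subseteq> carrier V" using assms by (simp add: basis_def)
  have "bij_betw (\<lambda>a. lincomb a S) (S \<rightarrow>\<^sub>E carrier K) (carrier V)"
  proof -
    have ex1: "\<exists>!a. a \<in> S \<rightarrow>\<^sub>E carrier K \<and> lincomb a S = v" if "v \<in> carrier V" for v
      using that assms basis_criterion[OF assms(1) S] by blast
    have closed: "lincomb a S \<in> carrier V" if "a \<in> S \<rightarrow>\<^sub>E carrier K" for a
      using that S by (intro lincomb_closed) auto
    show ?thesis
      unfolding bij_betw_def inj_on_def using ex1 closed by blast
  qed
  then have "card (carrier V) = card (S \<rightarrow>\<^sub>E carrier K)"
    by (simp add: bij_betw_same_card)
  then show ?thesis using assms by (simp add: card_PiE)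
qed

lemma (in vectorspace) finite_carrier_basis:
  assumes "finite (carrier V)"
  shows "\<exists>S. finite S \<and> basis S"
proof -
  have "span (carrier V) = carrier V"
    using in_own_span[of "carrier V"] span_is_subset2[of "carrier V"] by auto
  then have "fin_dim" unfolding fin_dim_def using assms by auto
  then show ?thesis by (rule finite_basis_exists)
qed

locale drinfeld_torsion = drinfeld_setting n t p0 p
  for n :: nat and t :: "'a :: finite_field alg_closure" and p0 p :: "'a poly" +
  fixes \<phi> :: "'a poly \<Rightarrow> 'a alg_closure poly"
  assumes drinfeld: "drinfeld_module r n t \<phi>"
begin

abbreviation \<kappa> :: "'a poly set ring" where "\<kappa> \<equiv> residue_class_ring p"
abbreviation M :: "('a poly set, 'a alg_closure) module" where "M \<equiv> torsion_module \<phi> p"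
abbreviation frob :: "'a alg_closure \<Rightarrow> 'a alg_closure" where "frob \<equiv> twisted_act (tau_pow r)"

lemma M_simps: "carrier M = {v. act p v = 0}" "\<zero>\<^bsub>M\<^esub> = 0" "v \<oplus>\<^bsub>M\<^esub> w = v + w"
  by (simp_all add: torsion_module_def twisted_act_drinfeld_module[OF drinfeld])

text \<open>
The scalar multiplication of the torsion module picks an arbitrary representative; another one
changes the result by \<open>\<phi>_(u p)\<close>, which is \<open>0\<close> on the torsion.
\<close>

lemma smult_residue:
  assumes "v \<in> carrier M"
  shows "residue p a \<odot>\<^bsub>M\<^esub> v = act a v"
proof -
  let ?b = "SOME x. x \<in> residue p a"
  obtain u where "?b - a = u * p"
    using some_residue[of p a] by (metis dvd_def mult.commute)
  then have "act ?b v = act (u * p + a) v" by (simp add: algebra_simps)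
  also have "\<dots> = act a v"
    using assms by (simp add: act_add act_mult M_simps)
  finally show ?thesis
    by (simp add: torsion_module_def twisted_act_drinfeld_module[OF drinfeld])
qed

lemma act_closed: "v \<in> carrier M \<Longrightarrow> act a v \<in> carrier M"
  by (simp add: M_simps mult.commute[of p] flip: act_mult) (simp add: act_mult)

lemma frob_eq: "frob v = v ^ (CARD('a) ^ r)"
  by (rule twisted_act_tau_pow)

lemma act_frob: "act a (frob v) = frob (act a v)"
  unfolding frob_eq by (rule act_frobenius[OF t_fixed])

lemma frob_closed: "v \<in> carrier M \<Longrightarrow> frob v \<in> carrier M"
  by (simp add: M_simps act_frob) (simp add: frob_eq)

lemma frob_funpow: "(frob ^^ k) v = v ^ (CARD('a) ^ (r * k))"
  by (induction k) (simp_all add: frob_eq frobenius_frobenius add.commute)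

lemma frob_funpow_closed: "v \<in> carrier M \<Longrightarrow> (frob ^^ k) v \<in> carrier M"
  by (induction k) (simp_all add: frob_closed)

interpretation E: module_endomorphism act frob
  by unfold_locales
     (simp_all add: act_add ev_add_right act_mult frob_eq frobenius_add act_frobenius[OF t_fixed])

lemma field_\<kappa>: "field \<kappa>"
  by (rule field_residue_class_ring[OF p(2)])

lemma vectorspace_M: "vectorspace \<kappa> M"
proof (rule vs_criteria[OF field_\<kappa>])
  show "\<zero>\<^bsub>M\<^esub> \<in> carrier M" by (simp add: M_simps)
  show "\<forall>v w. v \<in> carrier M \<and> w \<in> carrier M \<longrightarrow> v \<oplus>\<^bsub>M\<^esub> w \<in> carrier M"
    by (simp add: M_simps ev_add_right)
  show "\<forall>v\<in>carrier M. \<exists>neg_v\<in>carrier M. v \<oplus>\<^bsub>M\<^esub> neg_v = \<zero>\<^bsub>M\<^esub>"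
  proof
    fix v assume "v \<in> carrier M"
    then have "act (-1) v \<in> carrier M" by (rule act_closed)
    moreover have "act (-1) v = - v" by (simp add: act_uminus)
    ultimately show "\<exists>neg_v\<in>carrier M. v \<oplus>\<^bsub>M\<^esub> neg_v = \<zero>\<^bsub>M\<^esub>"
      by (auto simp: M_simps intro!: bexI[of _ "- v"])
  qed
  show "\<forall>c v. c \<in> carrier \<kappa> \<and> v \<in> carrier M \<longrightarrow> c \<odot>\<^bsub>M\<^esub> v \<in> carrier M"
    using act_closed by (auto simp: carrier_residue_class_ring smult_residue)
  show "\<forall>a b v. a \<in> carrier \<kappa> \<and> b \<in> carrier \<kappa> \<and> v \<in> carrier M \<longrightarrow>
      (a \<otimes>\<^bsub>\<kappa>\<^esub> b) \<odot>\<^bsub>M\<^esub> v = a \<odot>\<^bsub>M\<^esub> (b \<odot>\<^bsub>M\<^esub> v)"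
    by (auto simp: carrier_residue_class_ring smult_residue act_closed act_mult simp flip: residue_hom.hom_mult)
  show "\<forall>v\<in>carrier M. \<one>\<^bsub>\<kappa>\<^esub> \<odot>\<^bsub>M\<^esub> v = v"
    by (simp add: smult_residue flip: residue_hom.hom_one)
  show "\<forall>a b v. a \<in> carrier \<kappa> \<and> b \<in> carrier \<kappa> \<and> v \<in> carrier M \<longrightarrow>
      (a \<oplus>\<^bsub>\<kappa>\<^esub> b) \<odot>\<^bsub>M\<^esub> v = a \<odot>\<^bsub>M\<^esub> v \<oplus>\<^bsub>M\<^esub> b \<odot>\<^bsub>M\<^esub> v"
    by (auto simp: carrier_residue_class_ring smult_residue act_add M_simps(3) simp flip: residue_hom.hom_add)
  show "\<forall>a v w. a \<in> carrier \<kappa> \<and> v \<in> carrier M \<and> w \<in> carrier M \<longrightarrow>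
      a \<odot>\<^bsub>M\<^esub> (v \<oplus>\<^bsub>M\<^esub> w) = a \<odot>\<^bsub>M\<^esub> v \<oplus>\<^bsub>M\<^esub> a \<odot>\<^bsub>M\<^esub> w"
  proof (intro allI impI)
    fix a v w assume *: "a \<in> carrier \<kappa> \<and> v \<in> carrier M \<and> w \<in> carrier M"
    then have "v + w \<in> carrier M" by (simp add: M_simps ev_add_right)
    then show "a \<odot>\<^bsub>M\<^esub> (v \<oplus>\<^bsub>M\<^esub> w) = a \<odot>\<^bsub>M\<^esub> v \<oplus>\<^bsub>M\<^esub> a \<odot>\<^bsub>M\<^esub> w"
      using * by (auto simp: carrier_residue_class_ring smult_residue ev_add_right M_simps(3))
  qed
qed (simp_all add: M_simps)

sublocale V: vectorspace \<kappa> M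
  by (rule vectorspace_M)

lemma finsum_M:
  assumes "finite I" "\<And>i. i \<in> I \<Longrightarrow> g i \<in> carrier M"
  shows "(\<Oplus>\<^bsub>M\<^esub>i\<in>I. g i) = (\<Sum>i\<in>I. g i)"
  using assms
  by (induction I rule: finite_induct) (simp_all add: V.finsum_insert Pi_def M_simps(2,3))

lemma card_M: "card (carrier M) = CARD('a) ^ (n * degree p)" "finite (carrier M)"
  using card_act_kernel[OF p(1) p_no_root_t] by (simp_all add: M_simps)

text \<open>
Comparison of the order \<open>q^(n deg p)\<close> of \<open>M\<close> with the order \<open>q^(deg p)\<close> of the residue field.
\<close>

lemma card_basis:
  assumes "finite S" "V.basis S"
  shows "card S = n"
proof -
  have "degree p > 0"
    using p(2) by (auto simp: irreducible_def is_unit_iff_degree)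
  have "CARD('a) ^ (n * degree p) = CARD('a) ^ (degree p * card S)"
    using V.card_carrier_basis[OF assms]
    by (simp add: card_M card_residue_class_ring[OF p(2)] power_mult)
  then have "n * degree p = degree p * card S"
    using two_le_card_field[where 'a = 'a] by (subst (asm) power_inject_exp) auto
  then show ?thesis using \<open>degree p > 0\<close> by simp
qed

lemma linear_map_frob: "linear_map \<kappa> M M frob"
proof -
  have "frob \<in> module_hom \<kappa> M M"
    unfolding module_hom_def
    using frob_closed act_closed
    by (auto simp: carrier_residue_class_ring smult_residue M_simps(3) E.f_add act_frob)
  then show ?thesis
    unfolding linear_map_def mod_hom_def mod_hom_axioms_def
    using vectorspace_M V.module_axioms by blast
qed

lemma exists_matrix: "\<exists>bs B. is_matrix_of \<kappa> M frob bs B"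
proof -
  obtain S where S: "finite S" "V.basis S"
    using V.finite_carrier_basis[OF card_M(2)] by blast
  then have SM: "S \<subseteq> carrier M" by (simp add: V.basis_def)
  obtain bs where bs: "set bs = S" "distinct bs"
    using finite_distinct_list[OF S(1)] by blast
  have "\<exists>a. a \<in> S \<rightarrow>\<^sub>E carrier \<kappa> \<and> V.lincomb a S = frob (bs ! j)" if "j < length bs" for j
  proof -
    have "bs ! j \<in> carrier M" using that bs(1) SM nth_mem by blast
    then have "frob (bs ! j) \<in> carrier M" by (rule frob_closed)
    then show ?thesis using V.basis_criterion[OF S(1) SM] S(2) by blast
  qed
  then obtain a where a: "\<And>j. j < length bs \<Longrightarrow> a j \<in> S \<rightarrow>\<^sub>E carrier \<kappa> \<and> V.lincomb (a j) S = frob (bs ! j)"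
    by metis
  have "is_matrix_of \<kappa> M frob bs (\<lambda>i j. a j (bs ! i))"
    unfolding is_matrix_of_def
  proof (intro conjI allI impI)
    show "distinct bs" by fact
    show "V.basis (set bs)" using S bs by simp
    show "a j (bs ! i) \<in> carrier \<kappa>" if "i < length bs" "j < length bs" for i j
      using a[OF that(2)] that(1) bs(1) by (auto simp: PiE_def)
    show "frob (bs ! j) = (\<Oplus>\<^bsub>M\<^esub>i\<in>{..<length bs}. a j (bs ! i) \<odot>\<^bsub>M\<^esub> bs ! i)" if j: "j < length bs" for j
    proof -
      have cl: "a j v \<odot>\<^bsub>M\<^esub> v \<in> carrier M" if "v \<in> S" for v
        using a[OF j] SM that by (intro V.smult_closed) auto
      have "frob (bs ! j) = (\<Sum>v\<in>S. a j v \<odot>\<^bsub>M\<^esub> v)"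
        using a[OF j] finsum_M[OF S(1) cl] by (simp add: V.lincomb_def)
      also have "\<dots> = (\<Sum>i<length bs. a j (bs ! i) \<odot>\<^bsub>M\<^esub> bs ! i)"
        using bs by (intro sum.reindex_bij_betw[symmetric] bij_betw_nth) auto
      also have "\<dots> = (\<Oplus>\<^bsub>M\<^esub>i\<in>{..<length bs}. a j (bs ! i) \<odot>\<^bsub>M\<^esub> bs ! i)"
        using cl bs(1) by (intro finsum_M[symmetric]) auto
      finally show ?thesis .
    qed
  qed
  then show ?thesis by blast
qed

text \<open>
The polynomial \<open>X^n - p0\<close> over \<open>A\<close>, which reduces to \<open>X^n - c\<close>.
\<close>

abbreviation binom_lift :: "'a poly poly" where "binom_lift \<equiv> monom 1 n - monom p0 0"

lemma frob_funpow_n: "(frob ^^ n) v = act p0 v"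
  by (simp add: frob_funpow act_p0 mult.commute)

lemma coeff_binom_lift: "coeff binom_lift k = (if k = n then 1 else if k = 0 then - p0 else 0)"
  using n_pos by auto

lemma peval_binom_lift: "E.peval binom_lift v = 0"
proof -
  have "degree binom_lift \<le> n"
    by (intro degree_diff_le) (auto simp: degree_monom_le monom_0)
  then have "E.peval binom_lift v = (\<Sum>k\<le>n. act (coeff binom_lift k) ((frob ^^ k) v))"
    by (rule E.peval_atMost)
  also have "\<dots> = (\<Sum>k\<in>{0, n}. act (coeff binom_lift k) ((frob ^^ k) v))"
    by (rule sum.mono_neutral_right) (auto simp: coeff_binom_lift simp del: coeff_diff)
  also have "\<dots> = 0"
    using n_pos by (simp add: coeff_binom_lift frob_funpow_n act_uminus del: coeff_diff)
  finally show ?thesis .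
qed

lemma peval_zero_imp_dvd_coeffs:
  assumes "\<And>v. v \<in> carrier M \<Longrightarrow> E.peval g v = 0" "degree g < n"
  shows "p dvd coeff g i"
proof (cases "i < n")
  case True
  show ?thesis
  proof (rule frobenius_powers_independent[OF _ True])
    fix v assume "act p v = 0"
    then have "E.peval g v = 0" using assms by (simp add: M_simps)
    moreover have "E.peval g v = (\<Sum>k\<le>n - 1. act (coeff g k) ((frob ^^ k) v))"
      using assms(2) by (intro E.peval_atMost) simp
    moreover have "{..n - 1} = {..<n}" using n_pos by auto
    ultimately show "(\<Sum>i<n. act (coeff g i) (v ^ (CARD('a) ^ (r * i)))) = 0"
      by (simp add: frob_funpow)
  qed
next
  case False
  then show ?thesis using assms(2) by (simp add: coeff_eq_0)
qed

text \<open>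
The difference of two monic annihilators of degree \<open>n\<close> has smaller degree, so independence of the
powers of \<open>\<pi>\<close> makes it vanish modulo \<open>p\<close>.
\<close>

lemma monic_annihilator_unique:
  assumes "\<And>v. v \<in> carrier M \<Longrightarrow> E.peval g v = 0" "degree g = n" "lead_coeff g = 1"
  shows "residue_hom.coeffs_hom p g = residue_hom.coeffs_hom p binom_lift"
proof -
  have "E.peval (g - binom_lift) v = 0" if "v \<in> carrier M" for v
    using E.peval_add[of "g - binom_lift" binom_lift v] assms(1)[OF that] by (simp add: peval_binom_lift)
  moreover have "degree (g - binom_lift) < n"
  proof -
    have "degree (g - binom_lift) \<le> n"
      using assms(2) by (intro degree_diff_le) (auto simp: degree_monom_le monom_0)
    moreover have "coeff (g - binom_lift) n = 0"
      unfolding coeff_diff[of g] coeff_binom_lift using assms(2,3) by simp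
    ultimately show ?thesis
      using eq_zero_or_degree_less[of "g - binom_lift" n] n_pos by auto
  qed
  ultimately have "p dvd coeff (g - binom_lift) i" for i
    by (rule peval_zero_imp_dvd_coeffs)
  then show ?thesis
    unfolding coeff_diff[of g] by (simp add: residue_hom.coeffs_hom_def fun_eq_iff residue_eq_iff del: coeff_diff)
qed

lemma char_poly_of_matrix:
  assumes "is_matrix_of \<kappa> M frob bs B"
  shows "mat_char_poly \<kappa> (length bs) B = residue_hom.coeffs_hom p binom_lift"
proof -
  let ?m = "length bs"
  have bs: "distinct bs" "V.basis (set bs)"
    and B: "\<And>i j. i < ?m \<Longrightarrow> j < ?m \<Longrightarrow> B i j \<in> carrier \<kappa>"
    and fB: "\<And>j. j < ?m \<Longrightarrow> frob (bs ! j) = (\<Oplus>\<^bsub>M\<^esub>i\<in>{..<?m}. B i j \<odot>\<^bsub>M\<^esub> bs ! i)"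
    using assms by (auto simp: is_matrix_of_def)
  have m: "?m = n"
    using card_basis[OF _ bs(2)] distinct_card[OF bs(1)] by simp
  have bsM: "bs ! i \<in> carrier M" if "i < ?m" for i
    using bs(2) that by (auto simp: V.basis_def)
  have "\<exists>b. B i j = residue p b" if "i < ?m" "j < ?m" for i j
    using B[OF that] by (auto simp: carrier_residue_class_ring)
  then obtain b where b: "\<And>i j. i < ?m \<Longrightarrow> j < ?m \<Longrightarrow> B i j = residue p (b i j)"
    by metis
  define A where "A = mat ?m ?m (\<lambda>(i, j). b i j)"
  have A: "A \<in> carrier_mat ?m ?m" by (simp add: A_def)
  have frob_b: "frob (bs ! j) = (\<Sum>i<?m. act (A $$ (i, j)) (bs ! i))" if j: "j < ?m" for j
  proof -
    have "frob (bs ! j) = (\<Sum>i<?m. B i j \<odot>\<^bsub>M\<^esub> bs ! i)"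
      unfolding fB[OF j] using B[OF _ j] bsM by (intro finsum_M) auto
    also have "\<dots> = (\<Sum>i<?m. act (A $$ (i, j)) (bs ! i))"
      using j bsM by (intro sum.cong) (auto simp: b smult_residue A_def)
    finally show ?thesis .
  qed
  have CH: "E.peval (char_poly A) (bs ! l) = 0" if "l < ?m" for l
    by (rule E.cayley_hamilton[OF A frob_b that])
  have "E.peval (char_poly A) v = 0" if v: "v \<in> carrier M" for v
  proof -
    have S: "finite (set bs)" "set bs \<subseteq> carrier M" using bs by (auto simp: V.basis_def)
    obtain a where a: "a \<in> set bs \<rightarrow>\<^sub>E carrier \<kappa>" "V.lincomb a (set bs) = v"
      using V.basis_criterion[OF S] bs(2) v by blast
    have cl: "a w \<odot>\<^bsub>M\<^esub> w \<in> carrier M" if "w \<in> set bs" for w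
      using a S(2) that by (intro V.smult_closed) auto
    have "v = (\<Sum>w\<in>set bs. a w \<odot>\<^bsub>M\<^esub> w)"
      using a(2) finsum_M[OF S(1) cl] by (simp add: V.lincomb_def)
    moreover have "E.peval (char_poly A) (a w \<odot>\<^bsub>M\<^esub> w) = 0" if "w \<in> set bs" for w
    proof -
      have "a w \<in> carrier \<kappa>" using a(1) that by auto
      then obtain x where "a w = residue p x" by (auto simp: carrier_residue_class_ring)
      moreover have "w \<in> carrier M" using S(2) that by blast
      moreover have "E.peval (char_poly A) w = 0"
        using CH that by (metis in_set_conv_nth)
      ultimately show ?thesis by (simp add: smult_residue E.peval_scale)
    qed
    ultimately show ?thesis by (simp add: E.peval_sum_right)
  qed
  moreover have "degree (char_poly A) = n" "lead_coeff (char_poly A) = 1"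
    using degree_monic_char_poly[OF A] m by auto
  ultimately have "residue_hom.coeffs_hom p (char_poly A) = residue_hom.coeffs_hom p binom_lift"
    by (rule monic_annihilator_unique)
  moreover have "mat_char_poly \<kappa> ?m B = residue_hom.coeffs_hom p (char_poly A)"
    by (rule residue_hom.mat_char_poly_hom[OF A]) (simp add: b A_def)
  ultimately show ?thesis by simp
qed

lemma is_char_poly_binom_lift: "is_char_poly \<kappa> M frob (residue_hom.coeffs_hom p binom_lift)"
  unfolding is_char_poly_def
  using linear_map_frob exists_matrix char_poly_of_matrix by blast

text \<open>
Annihilation by a polynomial over the residue field can be tested on a lift to \<open>A\<close>. The bound on the
degree of the lift excludes terms beyond \<open>deg g\<close>, which a lift could have with coefficients divisible
by \<open>p\<close>.
\<close>

lemma annihilates_iff: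
  assumes g: "g \<in> carrier (UP \<kappa>)" and a: "\<And>i. up_ring.coeff (UP \<kappa>) g i = residue p (coeff G i)"
    and G: "degree G \<le> deg \<kappa> g"
  shows "annihilates \<kappa> M g frob \<longleftrightarrow> (\<forall>v\<in>carrier M. E.peval G v = 0)"
proof -
  have "(\<Oplus>\<^bsub>M\<^esub>i\<in>{..deg \<kappa> g}. up_ring.coeff (UP \<kappa>) g i \<odot>\<^bsub>M\<^esub> (frob ^^ i) v) = E.peval G v"
    if v: "v \<in> carrier M" for v
  proof -
    have "(\<Oplus>\<^bsub>M\<^esub>i\<in>{..deg \<kappa> g}. up_ring.coeff (UP \<kappa>) g i \<odot>\<^bsub>M\<^esub> (frob ^^ i) v)
      = (\<Sum>i\<in>{..deg \<kappa> g}. up_ring.coeff (UP \<kappa>) g i \<odot>\<^bsub>M\<^esub> (frob ^^ i) v)"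
      using frob_funpow_closed[OF v] act_closed by (intro finsum_M) (auto simp: a smult_residue)
    also have "\<dots> = (\<Sum>i\<le>deg \<kappa> g. act (coeff G i) ((frob ^^ i) v))"
      using frob_funpow_closed[OF v] by (intro sum.cong) (auto simp: a smult_residue)
    also have "\<dots> = E.peval G v" using E.peval_atMost[OF G] by simp
    finally show ?thesis .
  qed
  then show ?thesis by (simp add: annihilates_def M_simps(2))
qed

lemma is_min_poly_binom_lift: "is_min_poly \<kappa> M frob (residue_hom.coeffs_hom p binom_lift)"
proof -
  let ?\<chi> = "residue_hom.coeffs_hom p binom_lift"
  have U: "UP_ring \<kappa>"
    using cring_residue_class_ring by (intro UP_ring.intro cring.axioms(1))
  have \<chi>: "?\<chi> \<in> carrier (UP \<kappa>)"
    using residue_hom.coeffs_hom_in_up by (simp add: UP_def)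
  have coeff: "up_ring.coeff (UP \<kappa>) ?\<chi> i = residue p (coeff binom_lift i)" for i
    using residue_hom.coeffs_hom_in_up[of p binom_lift] by (simp add: UP_def residue_hom.coeffs_hom_def)
  have "\<not> p dvd 1" using p(2) by (auto simp: irreducible_def)
  then have one: "up_ring.coeff (UP \<kappa>) ?\<chi> n \<noteq> \<zero>\<^bsub>\<kappa>\<^esub>"
    by (simp add: coeff coeff_binom_lift residue_eq_zero_iff del: coeff_diff)
  have deg: "deg \<kappa> ?\<chi> = n"
  proof (rule antisym)
    show "deg \<kappa> ?\<chi> \<le> n"
      using \<chi> by (intro UP_ring.deg_aboveI[OF U]) (auto simp: coeff coeff_binom_lift residue_hom.hom_zero simp del: coeff_diff)
    show "n \<le> deg \<kappa> ?\<chi>"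
      using one \<chi> by (intro UP_ring.deg_belowI[OF U])
  qed
  have "degree binom_lift \<le> n"
    by (intro degree_diff_le) (auto simp: degree_monom_le monom_0)
  then have "annihilates \<kappa> M ?\<chi> frob"
    using annihilates_iff[OF \<chi> coeff] by (simp add: deg peval_binom_lift)
  moreover have "n \<le> deg \<kappa> g" if g: "g \<in> carrier (UP \<kappa>)" "g \<noteq> \<zero>\<^bsub>UP \<kappa>\<^esub>" "annihilates \<kappa> M g frob" for g
  proof (rule ccontr)
    assume "\<not> n \<le> deg \<kappa> g"
    have "\<exists>x. up_ring.coeff (UP \<kappa>) g i = residue p x" for i
      using UP.coeff_closed[OF g(1), of i] by (auto simp: carrier_residue_class_ring)
    then obtain x where x: "\<And>i. up_ring.coeff (UP \<kappa>) g i = residue p (x i)" by metis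
    \<comment> \<open>The lift is cut off at the degree, since the lift of a zero coefficient need not be zero.\<close>
    define G where "G = (\<Sum>i\<le>deg \<kappa> g. monom (x i) i)"
    have cG: "coeff G i = (if i \<le> deg \<kappa> g then x i else 0)" for i
      by (simp add: G_def coeff_sum)
    have a: "up_ring.coeff (UP \<kappa>) g i = residue p (coeff G i)" for i
      using x[of i] UP_ring.deg_aboveD[OF U, of g i] g(1) by (auto simp: cG residue_hom.hom_zero)
    have dG: "degree G \<le> deg \<kappa> g"
      by (rule degree_le) (simp add: cG)
    have "p dvd coeff G i" for i
    proof (rule peval_zero_imp_dvd_coeffs)
      show "degree G < n" using dG \<open>\<not> n \<le> deg \<kappa> g\<close> by simp
      show "E.peval G v = 0" if "v \<in> carrier M" for v
        using annihilates_iff[OF g(1) a dG] g(3) that by blast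
    qed
    then have "up_ring.coeff (UP \<kappa>) g i = \<zero>\<^bsub>\<kappa>\<^esub>" for i
      by (simp add: a residue_eq_zero_iff)
    then have "g = \<zero>\<^bsub>UP \<kappa>\<^esub>"
      using g(1) UP_ring.coeff_zero[OF U] UP_ring.UP_zero_closed[OF U]
      by (intro UP.up_eqI) auto
    then show False using g(2) by contradiction
  qed
  moreover have "up_ring.coeff (UP \<kappa>) ?\<chi> (deg \<kappa> ?\<chi>) = \<one>\<^bsub>\<kappa>\<^esub>"
    by (simp add: deg coeff coeff_binom_lift residue_hom.hom_one del: coeff_diff)
  ultimately show ?thesis
    unfolding is_min_poly_def using linear_map_frob \<chi> deg by auto
qed

end

theorem proposition2p4:
  fixes n r :: nat
    and p0 p :: "'a :: finite_field poly"
    and t :: "'a alg_closure"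
    and \<phi> :: "'a poly \<Rightarrow> 'a alg_closure poly"
  defines "\<kappa> \<equiv> residue_class_ring p"
    and "c \<equiv> PIdl\<^bsub>poly_A\<^esub> p +>\<^bsub>poly_A\<^esub> p0"
    and "M \<equiv> torsion_module \<phi> p"
    and "\<pi> \<equiv> (tau_pow r :: 'a alg_closure poly)"
  defines "\<chi> \<equiv> up_ring.monom (UP \<kappa>) \<one>\<^bsub>\<kappa>\<^esub> n \<ominus>\<^bsub>UP \<kappa>\<^esub> up_ring.monom (UP \<kappa>) c 0"
  assumes "n \<ge> 1"
    and "lead_coeff p0 = 1" and "irreducible p0" and "degree p0 = r" and "gcd n r = 1"
    and "t \<in> ext_field r" and "poly (map_poly to_ac p0) t = 0"
    and "drinfeld_module r n t \<phi>"
    and "lead_coeff p = 1" and "irreducible p" and "p \<noteq> p0"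
  shows "c \<in> Units \<kappa> \<and>
    ((\<forall>v\<in>carrier M. twisted_act (\<pi> [^]\<^bsub>twisted_poly_ring r\<^esub> n) v = c \<odot>\<^bsub>M\<^esub> v) \<and>
     is_char_poly \<kappa> M (twisted_act \<pi>) \<chi> \<and>
     \<chi> = reduce_coeffs poly_A (PIdl\<^bsub>poly_A\<^esub> p)
           (up_ring.monom (UP poly_A) 1 n \<ominus>\<^bsub>UP poly_A\<^esub> up_ring.monom (UP poly_A) p0 0)) \<and>
    (is_min_poly \<kappa> M (twisted_act \<pi>) \<chi> \<and>
     non_derogatory \<kappa> M (twisted_act \<pi>))"
proof -
  have r: "r = degree p0" using \<open>degree p0 = r\<close> by simp
  interpret D: drinfeld_torsion n t p0 p \<phi>
    using assms(6-) unfolding r by unfold_locales (auto simp: ext_field_def)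
  let ?binom = "Polynomial.monom 1 n - Polynomial.monom p0 0"
  have \<chi>: "\<chi> = residue_hom.coeffs_hom p ?binom"
    by (simp add: \<chi>_def \<kappa>_def c_def residue_hom.coeffs_hom_diff residue_hom.coeffs_hom_monom residue_hom.hom_one)
  have "c \<in> Units \<kappa>"
    unfolding c_def \<kappa>_def by (rule residue_unit[OF D.p(2) D.not_dvd_p0])
  moreover have "\<forall>v\<in>carrier M. twisted_act (\<pi> [^]\<^bsub>twisted_poly_ring r\<^esub> n) v = c \<odot>\<^bsub>M\<^esub> v"
    unfolding M_def c_def \<pi>_def
    by (simp add: twisted_act_tau_pow_power D.smult_residue D.act_p0 r mult.commute)
  moreover have "is_char_poly \<kappa> M (twisted_act \<pi>) \<chi>" "is_min_poly \<kappa> M (twisted_act \<pi>) \<chi>"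
    using D.is_char_poly_binom_lift D.is_min_poly_binom_lift
    unfolding \<chi> unfolding \<kappa>_def M_def \<pi>_def r by simp_all
  moreover have "\<chi> = reduce_coeffs poly_A (PIdl\<^bsub>poly_A\<^esub> p)
           (up_ring.monom (UP poly_A) 1 n \<ominus>\<^bsub>UP poly_A\<^esub> up_ring.monom (UP poly_A) p0 0)"
  proof -
    interpret I: type_ring_hom "poly_A :: 'a poly ring" "\<lambda>x. x"
      unfolding type_ring_hom_def type_ring_hom_axioms_def
      by (auto intro!: ring_hom_memI simp: ring_of_type_simps)
    have "up_ring.monom (UP poly_A) 1 n \<ominus>\<^bsub>UP poly_A\<^esub> up_ring.monom (UP poly_A) p0 0
      = I.coeffs_hom ?binom"
      by (simp add: I.coeffs_hom_diff I.coeffs_hom_monom)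
    moreover have "up_ring.coeff (UP poly_A) (I.coeffs_hom ?binom) i = coeff ?binom i" for i
      using I.coeffs_hom_in_up[of ?binom] by (simp add: UP_def I.coeffs_hom_def)
    ultimately show ?thesis
      by (simp add: \<chi> reduce_coeffs_def residue_hom.coeffs_hom_def)
  qed
  ultimately show ?thesis
    unfolding non_derogatory_def by blast
qed

end
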